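(* Let $G=(V,E)$ be a finite quiver without self-loops, with $V=\{1,\dots,p\}$, let $n_v\ge1$ be integers for $v\in V$, let $(x_e)_{e\in E}$ be complex numbers, and let $(U_e)_{e\in E}$ be complex matrices, $U_e$ of size $n_{s(e)}\times n_{t(e)}$. Let $\Delta$ be the associated twisted Laplacian, and let $T=\operatorname{diag}(t_uI_{n_u}:u\in V)$ with scalars $t_u$. Then $$\det(T+\Delta)=\sum_{\underline{0}\le\underline{k}\le\underline{n}}\underline{t}^{\underline{k}}\sum_{\substack{\mathsf{C}\in\mathcal{C}(G)\\ \underline{v}(\mathsf{C})+\underline{k}\le\underline{n}}}\binom{n_1-v_1(\mathsf{C})}{k_1}\cdots\binom{n_p-v_p(\mathsf{C})}{k_p}\frac{\underline{z}^{\underline{n}-\underline{k}-\underline{v}(\mathsf{C})}}{\mathsf{C}!}\,\underline{x}^{\underline{e}(\mathsf{C})}\prod_{\mathsf{c}\in\mathsf{C}}\frac{-\operatorname{Tr}\operatorname{hol}(\mathsf{c})}{\operatorname{val}(\mathsf{c})}.$$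
   Context: A finite quiver is a finite directed graph (multiple edges allowed); each edge $e$ goes from $s(e)$ to $t(e)$, and no self-loops means $s(e)\ne t(e)$ for all $e$. The twisted Laplacian is the endomorphism of $\bigoplus_{v\in V}\mathbb{C}^{n_v}$ given by $\Delta f(v)=\sum_{e\in E:\,s(e)=v}x_e\,[f(s(e))-U_ef(t(e))]$. For $a\in V$, $z_a=\sum_{e\in E:\,s(e)=a}x_e$. A cycle $\mathsf{c}$ on $G$ is a sequence of edges $(e_1,\dots,e_k)$, $k\ge 1$, with $t(e_i)=s(e_{i+1})$ for $1\le i<k$ and $t(e_k)=s(e_1)$, considered up to cyclic permutation (vertices and edges may be repeated). Its valuation $\operatorname{val}(\mathsf{c})$ is the order of the stabiliser of $(e_1,\dots,e_k)$ under the cyclic shift action of $\mathbb{Z}/k\mathbb{Z}$; $\underline{x}^{\underline{e}(\mathsf{c})}=x_{e_1}\cdots x_{e_k}$; $\operatorname{hol}(\mathsf{c})=U_{e_1}\cdots U_{e_k}$, whose trace does not depend on the starting point; $v_a(\mathsf{c})=|\{i:s(e_i)=a\}|$. $\mathcal{C}(G)$ is the set of finite multisets of cycles on $G$ (including the empty one). For $\mathsf{C}\in\mathcal{C}(G)$, counting multiplicities, $v_a(\mathsf{C})=\sum_{\mathsf{c}\in\mathsf{C}}v_a(\mathsf{c})$, $\underline{x}^{\underline{e}(\mathsf{C})}=\prod_{\mathsf{c}\in\mathsf{C}}\underline{x}^{\underline{e}(\mathsf{c})}$, the product over $\mathsf{c}\in\mathsf{C}$ takes multiplicities into account, and $\mathsf{C}!$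 is the product of the factorials of the multiplicities. Inequalities between integer vectors are componentwise, $\underline{n}=(n_1,\dots,n_p)$, and $\underline{t}^{\underline{m}}=\prod_at_a^{m_a}$, $\underline{z}^{\underline{m}}=\prod_az_a^{m_a}$ (with zeroth powers equal to $1$). *)

theory Defs
  imports
    Complex_Main
    "HOL-Library.FuncSet"
    "HOL-Library.Multiset"
    "Graph_Theory.Arc_Walk"
    "Jordan_Normal_Form.Determinant"
begin

text \<open>
  A quiver is a \<^typ>\<open>(nat, 'e) pre_digraph\<close> with vertex set \<open>{1..p}\<close>; the edge \<open>e\<close> goes from
  \<open>s(e) = tail G e\<close> to \<open>t(e) = head G e\<close>. An element of the direct sum of the spaces
  \<open>\<complex>^(n v)\<close> is a function \<open>f\<close> with \<open>f v \<in> carrier_vec (n v)\<close> for every vertex \<open>v\<close>.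
\<close>

definition twisted_laplacian ::
  "(nat, 'e) pre_digraph \<Rightarrow> (nat \<Rightarrow> nat) \<Rightarrow> ('e \<Rightarrow> complex) \<Rightarrow> ('e \<Rightarrow> complex mat)
    \<Rightarrow> (nat \<Rightarrow> complex vec) \<Rightarrow> (nat \<Rightarrow> complex vec)"
where
  "twisted_laplacian G n x U f v =
     finsum_vec TYPE(complex) (n v)
       (\<lambda>e. x e \<cdot>\<^sub>v (f (tail G e) - U e *\<^sub>v f (head G e)))
       (out_arcs G v)"

text \<open>
  The standard basis of the direct sum is indexed by the pairs \<open>(v, i)\<close> with \<open>1 \<le> v \<le> p\<close> and
  \<open>i < n v\<close>, listed lexicographically; this is the order underlying block matrices whose
  blocks are arranged by vertices \<open>1, \<dots>, p\<close>.
\<close>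

definition coord_list :: "nat \<Rightarrow> (nat \<Rightarrow> nat) \<Rightarrow> (nat \<times> nat) list" where
  "coord_list p n = concat (map (\<lambda>v. map (Pair v) [0..<n v]) [1..<Suc p])"

definition basis_section :: "(nat \<Rightarrow> nat) \<Rightarrow> nat \<times> nat \<Rightarrow> nat \<Rightarrow> complex vec" where
  "basis_section n b u = (if u = fst b then unit_vec (n u) (snd b) else 0\<^sub>v (n u))"

definition endo_matrix ::
  "nat \<Rightarrow> (nat \<Rightarrow> nat) \<Rightarrow> ((nat \<Rightarrow> complex vec) \<Rightarrow> (nat \<Rightarrow> complex vec)) \<Rightarrow> complex mat"
where
  "endo_matrix p n L =
     (let bs = coord_list p n; N = length bs in
      mat N N (\<lambda>(i, j). L (basis_section n (bs ! j)) (fst (bs ! i)) $ snd (bs ! i)))"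

definition diag_scalar_blocks :: "nat \<Rightarrow> (nat \<Rightarrow> nat) \<Rightarrow> (nat \<Rightarrow> complex) \<Rightarrow> complex mat" where
  "diag_scalar_blocks p n t = diag_block_mat (map (\<lambda>u. t u \<cdot>\<^sub>m 1\<^sub>m (n u)) [1..<Suc p])"

definition out_weight :: "('v, 'e) pre_digraph \<Rightarrow> ('e \<Rightarrow> complex) \<Rightarrow> 'v \<Rightarrow> complex" where
  "out_weight G x a = (\<Sum>e\<in>out_arcs G a. x e)"

text \<open>
  A cycle is a nonempty closed walk, with repeated vertices and edges allowed, up to cyclic
  permutation: an equivalence class of edge lists. (The library's \<^const>\<open>pre_digraph.cycle\<close>
  is more restrictive, as it forbids repeated vertices.)
\<close>

definition cyclic_perm :: "('v, 'e) pre_digraph \<Rightarrow> ('e list \<times> 'e list) set" where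
  "cyclic_perm G =
     {(es, es'). wf_digraph.closed_w G es \<and> wf_digraph.closed_w G es' \<and> (\<exists>m. es' = rotate m es)}"

definition cycles :: "('v, 'e) pre_digraph \<Rightarrow> 'e list set set" where
  "cycles G = {es. wf_digraph.closed_w G es} // cyclic_perm G"

text \<open>
  The value on a cycle of a function \<open>f\<close> of edge lists that is invariant under cyclic
  permutation. All functions used with it below are invariant on closed walks.
\<close>

definition on_cycle :: "('e list \<Rightarrow> 'b) \<Rightarrow> 'e list set \<Rightarrow> 'b" where
  "on_cycle f c = the_elem (f ` c)"

definition cycle_val :: "'e list set \<Rightarrow> nat" where
  "cycle_val = on_cycle (\<lambda>es. card {m. m < length es \<and> rotate m es = es})"

definition cycle_weight :: "('e \<Rightarrow> complex) \<Rightarrow> 'e list set \<Rightarrow> complex" where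
  "cycle_weight x = on_cycle (\<lambda>es. \<Prod>e\<leftarrow>es. x e)"

definition cycle_visits :: "('v, 'e) pre_digraph \<Rightarrow> 'v \<Rightarrow> 'e list set \<Rightarrow> nat" where
  "cycle_visits G a = on_cycle (\<lambda>es. card {i. i < length es \<and> tail G (es ! i) = a})"

text \<open>
  The identity matrix closing the product has size \<open>n (s(e\<^sub>1)) = n (t(e\<^sub>k))\<close>, so on
  a nonempty closed walk this is the product \<open>U e\<^sub>1 * \<dots> * U e\<^sub>k\<close>.
\<close>

definition walk_hol ::
  "('v, 'e) pre_digraph \<Rightarrow> ('v \<Rightarrow> nat) \<Rightarrow> ('e \<Rightarrow> complex mat) \<Rightarrow> 'e list \<Rightarrow> complex mat"
where
  "walk_hol G n U es = foldr (*) (map U es) (1\<^sub>m (n (tail G (hd es))))"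

definition mat_trace :: "complex mat \<Rightarrow> complex" where
  "mat_trace A = (\<Sum>i<dim_row A. A $$ (i, i))"

definition cycle_tr_hol ::
  "('v, 'e) pre_digraph \<Rightarrow> ('v \<Rightarrow> nat) \<Rightarrow> ('e \<Rightarrow> complex mat) \<Rightarrow> 'e list set \<Rightarrow> complex"
where
  "cycle_tr_hol G n U = on_cycle (\<lambda>es. mat_trace (walk_hol G n U es))"

definition cycle_multisets :: "('v, 'e) pre_digraph \<Rightarrow> 'e list set multiset set" where
  "cycle_multisets G = {C. set_mset C \<subseteq> cycles G}"

definition mset_visits :: "('v, 'e) pre_digraph \<Rightarrow> 'v \<Rightarrow> 'e list set multiset \<Rightarrow> nat" where
  "mset_visits G a C = (\<Sum>c\<in>#C. cycle_visits G a c)"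

definition mset_weight :: "('e \<Rightarrow> complex) \<Rightarrow> 'e list set multiset \<Rightarrow> complex" where
  "mset_weight x C = (\<Prod>c\<in>#C. cycle_weight x c)"

definition mset_fact :: "'a multiset \<Rightarrow> complex" where
  "mset_fact C = (\<Prod>c\<in>set_mset C. fact (count C c))"

end

theory Submission
  imports Defs "HOL-Computational_Algebra.Polynomial_FPS" "Jordan_Normal_Form.Schur_Decomposition"
begin

text \<open>
  Write \<open>d a = t a + out_weight G x a\<close>. In the coordinates given by the pairs \<open>(v, i)\<close>, the matrix
  T + \<Delta> is D - X, where D is diagonal with entries \<open>d v\<close> and X has blocks \<Sum>e. x e * U e, the sum
  being over the edges from one vertex to another (\<open>endo_matrix_twisted_laplacian\<close>). By the binomial
  theorem applied to each power of \<open>d a\<close>, the claim reduces to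

    det(D - X) = \<Sum>C. (\<Prod>a. d a ^ (n a - v_a(C))) * W(C),

  where C runs over the multisets of cycles with v_a(C) \<open>\<le>\<close> \<open>n a\<close> for all a, and W(C) is 1/C! times the
  product of the weights - \<open>x\<close> Tr hol / val of its cycles (\<open>det_diag_minus_transport\<close>).

  Scale the rows of vertex a by a variable \<open>y a\<close>, giving the matrix YX. Formally, det(1 - YX) is the
  exponential of - \<Sum>k. Tr((YX)^k) / k. The trace of (YX)^k is a sum over closed walks of length k
  (\<open>trace_kernel_mat_pow\<close>); a cycle of length k has k / val representatives
  (\<open>card_rotation_class\<close>), so the exponent is the sum over all cycles of their weights, and the
  exponential of such a sum is a sum over multisets with the factor 1/C!. Instead of manipulating
  infinite series, one compares the homogeneous parts of both sides: Newton's identities give a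
  recurrence for those of det(1 - A) (\<open>det_one_minus_newton\<close>), and marking a cycle in a multiset gives
  the same recurrence for the sums over multisets (\<open>sum_mset_terms_recurrence\<close>).

  In this way the determinant is a sum over all multisets of total length at most the size of the
  matrix. Many of these visit some vertex a more than \<open>n a\<close> times. The determinant has degree at most
  \<open>n a\<close> in \<open>y a\<close>, because this variable occurs in \<open>n a\<close> rows only, so the excessive terms cancel and can
  be removed, one vertex at a time (\<open>det_one_minus_transport_bounded\<close>). Taking \<open>y a = 1 / d a\<close> yields
  the formula for invertible D, and continuity yields it in general.
\<close>

section \<open>Newton's identities for the determinant of 1 - A\<close>

text \<open>
  Compare coefficients in the logarithmic derivative: for P the product of the factors
  1 - l X, the series X P' / P is minus the generating series of the power sums, and each factor
  adds its own geometric series.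
\<close>

lemma newton_identities:
  fixes ls :: "'a :: field list"
  shows "of_nat m * coeff (\<Prod>l\<leftarrow>ls. [:1, -l:]) m
    = - (\<Sum>k=1..m. (\<Sum>l\<leftarrow>ls. l ^ k) * coeff (\<Prod>l\<leftarrow>ls. [:1, -l:]) (m - k))"
proof -
  define S where "S ls = Abs_fps (\<lambda>k. if k = 0 then 0 else (\<Sum>l\<leftarrow>ls. l ^ k))" for ls :: "'a list"
  define P where "P ls = fps_of_poly (\<Prod>l\<leftarrow>ls. [:1, -l:])" for ls :: "'a list"
  have log_deriv: "fps_X * fps_deriv (P ls) = - (S ls * P ls)" for ls
  proof (induction ls)
    case Nil
    have "S [] = 0" by (rule fps_ext) (simp add: S_def)
    then show ?case by (simp add: P_def)
  next
    case (Cons a ls)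
    \<comment> \<open>The power series of the powers a^k with k > 0 is a X / (1 - a X).\<close>
    have geom: "(1 - fps_const a * fps_X) * S [a] = fps_const a * fps_X"
    proof (rule fps_ext)
      fix k show "fps_nth ((1 - fps_const a * fps_X) * S [a]) k = fps_nth (fps_const a * fps_X) k"
        by (cases k; cases "k - 1") (auto simp: S_def left_diff_distrib mult.assoc)
    qed
    have S: "S (a # ls) = S [a] + S ls" by (rule fps_ext) (simp add: S_def)
    have lin: "fps_of_poly [:1, -a:] = 1 - fps_const a * fps_X"
      by (simp add: fps_of_poly_pCons mult.commute)
    have P: "P (a # ls) = (1 - fps_const a * fps_X) * P ls"
      unfolding P_def by (simp only: list.map prod_list.Cons fps_of_poly_mult lin)
    have "fps_X * fps_deriv (P (a # ls))
        = (1 - fps_const a * fps_X) * (fps_X * fps_deriv (P ls)) - fps_const a * fps_X * P ls"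
      by (simp add: P algebra_simps)
    also have "\<dots> = - ((1 - fps_const a * fps_X) * S ls * P ls) - (1 - fps_const a * fps_X) * S [a] * P ls"
      by (simp only: Cons.IH geom) (simp add: algebra_simps)
    also have "\<dots> = - (S (a # ls) * P (a # ls))"
      by (simp add: P S algebra_simps)
    finally show ?case .
  qed
  have "of_nat m * coeff (\<Prod>l\<leftarrow>ls. [:1, -l:]) m = fps_nth (fps_X * fps_deriv (P ls)) m"
    by (cases m) (simp_all add: P_def)
  also have "\<dots> = - (\<Sum>k=0..m. fps_nth (S ls) k * fps_nth (P ls) (m - k))"
    by (simp add: log_deriv fps_mult_nth)
  also have "(\<Sum>k=0..m. fps_nth (S ls) k * fps_nth (P ls) (m - k))
      = (\<Sum>k=1..m. fps_nth (S ls) k * fps_nth (P ls) (m - k))"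
    by (rule sum.mono_neutral_right) (auto simp: S_def)
  also have "\<dots> = (\<Sum>k=1..m. (\<Sum>l\<leftarrow>ls. l ^ k) * coeff (\<Prod>l\<leftarrow>ls. [:1, -l:]) (m - k))"
    by (rule sum.cong) (auto simp: S_def P_def)
  finally show ?thesis .
qed

lemma mat_trace_mult_commute:
  assumes "A \<in> carrier_mat m n" "B \<in> carrier_mat n m"
  shows "mat_trace (A * B) = mat_trace (B * A)"
proof -
  have "mat_trace (A * B) = (\<Sum>i<m. \<Sum>j<n. A $$ (i, j) * B $$ (j, i))"
    using assms by (auto simp: mat_trace_def scalar_prod_def lessThan_atLeast0 intro!: sum.cong)
  also have "\<dots> = (\<Sum>j<n. \<Sum>i<m. B $$ (j, i) * A $$ (i, j))"
    by (subst sum.swap) (simp add: mult.commute)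
  also have "\<dots> = mat_trace (B * A)"
    using assms by (auto simp: mat_trace_def scalar_prod_def lessThan_atLeast0 intro!: sum.cong)
  finally show ?thesis .
qed

text \<open>
  On the diagonal of a product of upper triangular matrices only the diagonal entries
  contribute: an off-diagonal index has a zero factor on one side or the other.
\<close>

lemma upper_triangular_pow:
  assumes A: "(A :: 'a :: comm_semiring_1 mat) \<in> carrier_mat n n" and ut: "upper_triangular A"
  shows "upper_triangular (A ^\<^sub>m k) \<and> (\<forall>i<n. (A ^\<^sub>m k) $$ (i, i) = A $$ (i, i) ^ k)"
proof (induction k)
  case 0
  then show ?case using A by (auto intro!: upper_triangularI)
next
  case (Suc k)
  have C: "A ^\<^sub>m k \<in> carrier_mat n n" using A by simp
  have ent: "(A ^\<^sub>m Suc k) $$ (i, j) = (\<Sum>l<n. (A ^\<^sub>m k) $$ (i, l) * A $$ (l, j))"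
    if "i < n" "j < n" for i j
    using A C that by (auto simp: scalar_prod_def lessThan_atLeast0 intro!: sum.cong)
  have vanish: "(A ^\<^sub>m k) $$ (i, l) * A $$ (l, j) = 0"
    if "i < n" "j < n" "l < n" "l < i \<or> j < l" for i j l
  proof -
    have "(A ^\<^sub>m k) $$ (i, l) = 0" if "l < i"
      by (rule upper_triangularD) (use Suc.IH that \<open>i < n\<close> C in auto)
    moreover have "A $$ (l, j) = 0" if "j < l"
      by (rule upper_triangularD[OF ut that]) (use \<open>l < n\<close> A in auto)
    ultimately show ?thesis using that by auto
  qed
  have diag: "(A ^\<^sub>m Suc k) $$ (i, i) = A $$ (i, i) ^ Suc k" if i: "i < n" for i
  proof -
    have "(\<Sum>l<n. (A ^\<^sub>m k) $$ (i, l) * A $$ (l, i)) = (\<Sum>l\<in>{i}. (A ^\<^sub>m k) $$ (i, l) * A $$ (l, i))"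
      by (rule sum.mono_neutral_right) (use i vanish in \<open>auto simp: neq_iff\<close>)
    then show ?thesis using ent[OF i i] Suc.IH i by (simp add: mult.commute)
  qed
  have "upper_triangular (A ^\<^sub>m Suc k)"
  proof (rule upper_triangularI)
    fix i j assume "j < i" "i < dim_row (A ^\<^sub>m Suc k)"
    then have ij: "j < i" "i < n" "j < n" using A by auto
    have "(\<Sum>l<n. (A ^\<^sub>m k) $$ (i, l) * A $$ (l, j)) = 0"
      by (rule sum.neutral, intro ballI vanish) (use ij in auto)
    then show "(A ^\<^sub>m Suc k) $$ (i, j) = 0" using ent[of i j] ij by simp
  qed
  then show ?case using diag by blast
qed

text \<open>
  After Schur triangularisation, which changes neither the determinant of 1 - A nor the traces of
  the powers, the numbers \<open>e m\<close> are up to sign the elementary symmetric functions of the eigenvalues,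
  and the traces are their power sums. There are only \<open>N\<close> eigenvalues, so the sum stops at \<open>N\<close>.
\<close>

lemma det_one_minus_newton:
  assumes A: "(A :: complex mat) \<in> carrier_mat N N"
  obtains e where "det (1\<^sub>m N - A) = (\<Sum>m\<le>N. e m)" "e 0 = 1"
    "\<And>m. of_nat m * e m = - (\<Sum>k=1..m. mat_trace (A ^\<^sub>m k) * e (m - k))"
proof -
  obtain as where as: "char_poly A = (\<Prod>a\<leftarrow>as. [:- a, 1:])" and len: "length as = N"
    using char_poly_factorized[OF A] by blast
  obtain B P Q where "schur_decomposition A as = (B, P, Q)" by (cases "schur_decomposition A as")
  from schur_decomposition[OF A as this]
  have wit: "similar_mat_wit A B P Q" and ut: "upper_triangular B" and dg: "diag_mat B = as" by auto
  have trace: "mat_trace (A ^\<^sub>m k) = (\<Sum>a\<leftarrow>as. a ^ k)" for k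
  proof -
    from similar_mat_wit_pow[OF wit, of k]
    have w: "similar_mat_wit (A ^\<^sub>m k) (B ^\<^sub>m k) P Q" .
    have c: "A ^\<^sub>m k \<in> carrier_mat N N" "B ^\<^sub>m k \<in> carrier_mat N N" "P \<in> carrier_mat N N"
      "Q \<in> carrier_mat N N" and QP: "Q * P = 1\<^sub>m N" and eq: "A ^\<^sub>m k = P * (B ^\<^sub>m k) * Q"
      using w A unfolding similar_mat_wit_def Let_def by auto
    have B: "B \<in> carrier_mat N N" using wit A unfolding similar_mat_wit_def Let_def by auto
    have "mat_trace (A ^\<^sub>m k) = mat_trace (Q * (P * (B ^\<^sub>m k)))"
      unfolding eq by (rule mat_trace_mult_commute) (use c in auto)
    also have "Q * (P * (B ^\<^sub>m k)) = B ^\<^sub>m k"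
      using c QP by (subst assoc_mult_mat[symmetric, of _ N N _ N _ N]) auto
    also have "mat_trace (B ^\<^sub>m k) = (\<Sum>i<N. B $$ (i, i) ^ k)"
      using upper_triangular_pow[OF B ut, of k] B by (simp add: mat_trace_def)
    also have "\<dots> = (\<Sum>a\<leftarrow>as. a ^ k)"
      unfolding dg[symmetric] diag_mat_def using B
      by (simp add: sum_list_distinct_conv_sum_set o_def atLeast0LessThan)
    finally show ?thesis .
  qed
  define p where "p = (\<Prod>a\<leftarrow>as. [:1, - a:])"
  have deg: "degree p \<le> N"
  proof -
    have "degree p \<le> sum_list (map degree (map (\<lambda>a. [:1, - a:]) as))"
      unfolding p_def by (rule degree_prod_list_le)
    also have "\<dots> \<le> sum_list (map (\<lambda>_. 1) as)"
      unfolding map_map by (rule sum_list_mono) auto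
    finally show ?thesis using len by (simp add: sum_list_triv)
  qed
  have "det (1\<^sub>m N - A) = poly (det (char_poly_matrix A)) 1"
    by (rule poly_det_cong[symmetric]) (use A in \<open>auto simp: char_poly_matrix_def\<close>)
  also have "\<dots> = (\<Prod>a\<leftarrow>as. poly [:- a, 1:] 1)"
    by (subst char_poly_def[symmetric], subst as) (simp add: poly_prod_list o_def)
  also have "\<dots> = poly p 1" by (simp add: p_def poly_prod_list o_def)
  also have "\<dots> = (\<Sum>m\<le>N. coeff p m)"
    using deg by (subst poly_altdef) (auto intro!: sum.mono_neutral_left le_degree)
  finally have det: "det (1\<^sub>m N - A) = (\<Sum>m\<le>N. coeff p m)" .
  have c0: "coeff p 0 = 1"
    unfolding p_def poly_0_coeff_0[symmetric] poly_prod_list by (induction as) auto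
  show thesis
    by (rule that[of "coeff p"]) (use det c0 newton_identities[of _ as] trace in \<open>simp_all add: p_def\<close>)
qed

section \<open>Exponential sums over multisets\<close>

text \<open>
  The monomial of a multiset in an exponential series: over all multisets it sums formally to
  exp of the sum of \<open>g\<close>.
\<close>

definition mset_term :: "('a \<Rightarrow> complex) \<Rightarrow> 'a multiset \<Rightarrow> complex" where
  "mset_term g C = (\<Prod>c\<in>#C. g c) / mset_fact C"

definition msets_of_length :: "'a set \<Rightarrow> ('a \<Rightarrow> nat) \<Rightarrow> nat \<Rightarrow> 'a multiset set" where
  "msets_of_length A l m = {C. set_mset C \<subseteq> A \<and> (\<Sum>c\<in>#C. l c) = m}"

lemma mset_fact_nonzero: "mset_fact C \<noteq> 0"
  by (simp add: mset_fact_def)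

text \<open>
  Only the factor of \<open>c\<close> changes, and when \<open>c\<close> was absent from \<open>C\<close> the missing factor is
  0! = 1.
\<close>

lemma mset_fact_add_mset: "mset_fact (add_mset c C) = of_nat (Suc (count C c)) * mset_fact C"
proof -
  have "mset_fact (add_mset c C)
      = fact (Suc (count C c)) * (\<Prod>d\<in>set_mset C - {c}. fact (count C d))"
    unfolding mset_fact_def set_mset_add_mset_insert
    by (subst prod.insert_remove) (simp, simp, rule disjI2, rule prod.cong, auto)
  also have "\<dots> = of_nat (Suc (count C c)) * (fact (count C c) * (\<Prod>d\<in>set_mset C - {c}. fact (count C d)))"
    by (simp add: algebra_simps)
  also have "fact (count C c) * (\<Prod>d\<in>set_mset C - {c}. fact (count C d)) = mset_fact C"
    unfolding mset_fact_def
    by (cases "c \<in># C") (auto simp: prod.remove not_in_iff)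
  finally show ?thesis .
qed

text \<open>
  The combinatorial form of the rule that exp is its own derivative: marking one of the copies of
  \<open>c\<close> amounts to removing it.
\<close>

lemma mset_term_add_mset:
  "of_nat (count (add_mset c C) c) * mset_term g (add_mset c C) = g c * mset_term g C"
  using mset_fact_nonzero[of C]
  by (simp add: mset_term_def mset_fact_add_mset divide_simps del: of_nat_Suc)

lemma sum_mset_eq_sum_count:
  fixes l :: "'a \<Rightarrow> nat"
  assumes "finite S" "set_mset C \<subseteq> S"
  shows "(\<Sum>c\<in>#C. l c) = (\<Sum>c\<in>S. count C c * l c)"
  using assms(2)
proof (induction C)
  case (add d C)
  have "(\<Sum>c\<in>S. count (add_mset d C) c * l c)
      = (\<Sum>c\<in>S. (if c = d then l c else 0) + count C c * l c)"
    by (rule sum.cong) auto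
  also have "\<dots> = l d + (\<Sum>c\<in>S. count C c * l c)"
    using assms(1) add.prems by (simp add: sum.distrib)
  finally show ?case using add by simp
qed simp

lemma length_le_sum_mset: "c \<in># C \<Longrightarrow> (l c :: nat) \<le> (\<Sum>c\<in>#C. l c)"
  by (metis le_add1 multi_member_split image_mset_add_mset sum_mset.insert)

lemma finite_msets_of_length:
  assumes pos: "\<And>c. c \<in> A \<Longrightarrow> l c > 0" and fin: "finite {c \<in> A. l c \<le> m}"
  shows "finite (msets_of_length A l m)"
proof (rule finite_subset)
  show "msets_of_length A l m \<subseteq> mset ` {cs. set cs \<subseteq> {c \<in> A. l c \<le> m} \<and> length cs \<le> m}"
  proof
    fix C assume C: "C \<in> msets_of_length A l m"
    obtain cs where cs: "C = mset cs" using ex_mset by metis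
    have "size C \<le> (\<Sum>c\<in>#C. l c)"
    proof -
      have "size C = (\<Sum>c\<in>#C. 1)" by simp
      also have "\<dots> \<le> (\<Sum>c\<in>#C. l c)"
        by (rule sum_mset_mono) (use C pos in \<open>auto simp: msets_of_length_def Suc_le_eq\<close>)
      finally show ?thesis .
    qed
    then show "C \<in> mset ` {cs. set cs \<subseteq> {c \<in> A. l c \<le> m} \<and> length cs \<le> m}"
      using C length_le_sum_mset[of _ C l] unfolding cs msets_of_length_def by auto
  qed
  show "finite (mset ` {cs. set cs \<subseteq> {c \<in> A. l c \<le> m} \<and> length cs \<le> m})"
    using finite_lists_length_le[OF fin] by auto
qed

lemma msets_of_length_0:
  assumes pos: "\<And>c. c \<in> A \<Longrightarrow> l c > 0"
  shows "msets_of_length A l 0 = {{#}}"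
proof -
  have "C = {#}" if "set_mset C \<subseteq> A" "\<forall>c\<in>#C. l c = 0" for C
  proof (rule ccontr)
    assume "C \<noteq> {#}"
    then obtain c where "c \<in># C" by blast
    with that pos[of c] show False by auto
  qed
  then show ?thesis by (auto simp: msets_of_length_def)
qed

text \<open>
  Double counting: write the total length \<open>m\<close> as the sum over \<open>c\<close> of its length times its
  multiplicity, and remove a marked copy of \<open>c\<close> from every multiset. This is the recurrence that
  Newton's identities give for the numbers \<open>e m\<close>, once traces are sums over cycles.
\<close>

lemma sum_mset_terms_recurrence:
  assumes pos: "\<And>c. c \<in> A \<Longrightarrow> l c > 0" and fin: "finite {c \<in> A. l c \<le> m}"
  shows "of_nat m * (\<Sum>C\<in>msets_of_length A l m. mset_term g C)
    = (\<Sum>c\<in>{c \<in> A. l c \<le> m}. of_nat (l c) * g c * (\<Sum>C\<in>msets_of_length A l (m - l c). mset_term g C))"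
proof -
  let ?M = "msets_of_length A l"
  let ?A = "{c \<in> A. l c \<le> m}"
  have finM: "finite (?M m)" by (rule finite_msets_of_length[OF pos fin])
  have len: "of_nat m = (\<Sum>c\<in>?A. of_nat (l c) * of_nat (count C c) :: complex)" if C: "C \<in> ?M m" for C
  proof -
    have sub: "set_mset C \<subseteq> ?A" using C length_le_sum_mset[of _ C l] by (auto simp: msets_of_length_def)
    have "m = (\<Sum>c\<in>?A. count C c * l c)"
      using C sum_mset_eq_sum_count[OF fin sub, of l] by (simp add: msets_of_length_def)
    then have "of_nat m = (of_nat (\<Sum>c\<in>?A. count C c * l c) :: complex)" by simp
    then show ?thesis by (simp add: mult.commute)
  qed
  have peel: "(\<Sum>C\<in>?M m. of_nat (count C c) * mset_term g C) = g c * (\<Sum>C\<in>?M (m - l c). mset_term g C)"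
    if c: "c \<in> ?A" for c
  proof -
    have "(\<Sum>C\<in>?M m. of_nat (count C c) * mset_term g C)
        = (\<Sum>C\<in>{C \<in> ?M m. c \<in># C}. of_nat (count C c) * mset_term g C)"
      by (rule sum.mono_neutral_right[OF finM]) (auto simp: not_in_iff)
    also have "{C \<in> ?M m. c \<in># C} = add_mset c ` ?M (m - l c)"
    proof -
      have "C \<in> add_mset c ` ?M (m - l c)" if "C \<in> ?M m" "c \<in># C" for C
      proof -
        from multi_member_split[OF that(2)] obtain D where D: "C = add_mset c D" by blast
        then have "D \<in> ?M (m - l c)" using that(1) by (auto simp: msets_of_length_def)
        with D show ?thesis by blast
      qed
      then show ?thesis using c by (auto simp: msets_of_length_def)
    qed
    also have "(\<Sum>C\<in>add_mset c ` ?M (m - l c). of_nat (count C c) * mset_term g C)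
        = (\<Sum>C\<in>?M (m - l c). g c * mset_term g C)"
      by (subst sum.reindex) (auto simp: inj_on_def mset_term_add_mset simp del: count_add_mset)
    finally show ?thesis by (simp add: sum_distrib_left)
  qed
  have "of_nat m * (\<Sum>C\<in>?M m. mset_term g C)
      = (\<Sum>C\<in>?M m. \<Sum>c\<in>?A. of_nat (l c) * (of_nat (count C c) * mset_term g C))"
    unfolding sum_distrib_left
  proof (rule sum.cong[OF refl])
    fix C assume "C \<in> ?M m"
    from len[OF this] show "of_nat m * mset_term g C
        = (\<Sum>c\<in>?A. of_nat (l c) * (of_nat (count C c) * mset_term g C))"
      by (metis (no_types, lifting) mult.assoc sum.cong sum_distrib_right)
  qed
  also have "\<dots> = (\<Sum>c\<in>?A. of_nat (l c) * (\<Sum>C\<in>?M m. of_nat (count C c) * mset_term g C))"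
    by (subst sum.swap) (simp add: sum_distrib_left)
  also have "\<dots> = (\<Sum>c\<in>?A. of_nat (l c) * g c * (\<Sum>C\<in>?M (m - l c). mset_term g C))"
    by (rule sum.cong) (auto simp: peel mult.assoc)
  finally show ?thesis .
qed

text \<open>
  Formally det(1 - A) = exp(- \<Sum>k. tr(A^k) / k). If the traces are written as sums over objects
  \<open>c\<close> of length k, this becomes exp of the sum of \<open>g\<close>, hence a sum over multisets. Both sides
  satisfy the same recurrence, degree by degree, with the same value 1 in degree 0, so no
  convergence is involved.
\<close>

lemma det_one_minus_eq_sum_msets:
  assumes A: "(A :: complex mat) \<in> carrier_mat N N"
    and pos: "\<And>c. c \<in> K \<Longrightarrow> l c > 0"
    and fin: "\<And>m. finite {c \<in> K. l c \<le> m}"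
    and trace: "\<And>k. k > 0 \<Longrightarrow> mat_trace (A ^\<^sub>m k) = - (\<Sum>c\<in>{c \<in> K. l c = k}. of_nat k * g c)"
  shows "det (1\<^sub>m N - A) = (\<Sum>C\<in>{C. set_mset C \<subseteq> K \<and> (\<Sum>c\<in>#C. l c) \<le> N}. mset_term g C)"
proof -
  obtain e where det: "det (1\<^sub>m N - A) = (\<Sum>m\<le>N. e m)" and e0: "e 0 = 1"
    and rec: "\<And>m. of_nat m * e m = - (\<Sum>k=1..m. mat_trace (A ^\<^sub>m k) * e (m - k))"
    using det_one_minus_newton[OF A] by blast
  let ?E = "\<lambda>m. \<Sum>C\<in>msets_of_length K l m. mset_term g C"
  have "e m = ?E m" for m
  proof (induction m rule: less_induct)
    case (less m)
    show ?case
    proof (cases "m = 0")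
      case True
      then show ?thesis by (simp add: msets_of_length_0[OF pos] e0 mset_term_def mset_fact_def)
    next
      case False
      have "of_nat m * e m = (\<Sum>k=1..m. \<Sum>c\<in>{c \<in> K. l c = k}. of_nat k * g c * e (m - k))"
        unfolding rec by (simp add: trace sum_negf sum_distrib_right)
      also have "\<dots> = (\<Sum>k=1..m. \<Sum>c\<in>{c \<in> {c \<in> K. l c \<le> m}. l c = k}. of_nat (l c) * g c * ?E (m - l c))"
        by (intro sum.cong) (auto simp: less.IH)
      also have "\<dots> = (\<Sum>c\<in>{c \<in> K. l c \<le> m}. of_nat (l c) * g c * ?E (m - l c))"
        by (rule sum.group) (use pos in \<open>auto simp: fin Suc_le_eq\<close>)
      also have "\<dots> = of_nat m * ?E m"
        by (rule sum_mset_terms_recurrence[OF pos fin, symmetric])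
      finally show ?thesis using False by simp
    qed
  qed
  then have "det (1\<^sub>m N - A) = (\<Sum>m\<le>N. ?E m)" using det by simp
  also have "\<dots> = (\<Sum>C\<in>(\<Union>m\<le>N. msets_of_length K l m). mset_term g C)"
    by (rule sum.UNION_disjoint[symmetric])
       (auto simp: finite_msets_of_length[OF pos fin], auto simp: msets_of_length_def)
  also have "(\<Union>m\<le>N. msets_of_length K l m) = {C. set_mset C \<subseteq> K \<and> (\<Sum>c\<in>#C. l c) \<le> N}"
    by (auto simp: msets_of_length_def)
  finally show ?thesis .
qed

section \<open>Closed walks and their rotation classes\<close>

definition rotation_class :: "'e list \<Rightarrow> 'e list set" where
  "rotation_class es = (\<lambda>m. rotate m es) ` {..<length es}"

definition cycle_length :: "'e list set \<Rightarrow> nat" where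
  "cycle_length = on_cycle length"

lemma rotate_inj: "rotate m xs = rotate m ys \<Longrightarrow> xs = ys"
proof (induction m)
  case (Suc m)
  then have "rotate1 (rotate m xs) = rotate1 (rotate m ys)" by simp
  then have "rotate m xs = rotate m ys"
    by (cases "rotate m xs"; cases "rotate m ys") auto
  then show ?case by (rule Suc.IH)
qed simp

lemma rotate_eq_rotate_iff:
  "rotate (m + j) es = rotate j es \<longleftrightarrow> rotate m es = es"
proof -
  have "rotate (m + j) es = rotate j (rotate m es)" by (simp add: rotate_rotate add.commute)
  then show ?thesis using rotate_inj[of j "rotate m es" es] by auto
qed

text \<open>
  Orbit and stabiliser for the cyclic shifts: each fibre of \<open>m \<mapsto> rotate m es\<close> on \<open>{..<length es}\<close> is a
  translate of the stabiliser modulo the length, hence has the same size.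
\<close>

lemma card_rotation_class:
  assumes "es \<noteq> []"
  shows "card (rotation_class es) * card {m. m < length es \<and> rotate m es = es} = length es"
proof -
  define L where "L = length es"
  have L: "L > 0" using assms by (simp add: L_def)
  have fiber: "card {m \<in> {..<L}. rotate m es = es'} = card {m. m < L \<and> rotate m es = es}"
    if "es' \<in> rotation_class es" for es'
  proof -
    from that obtain j where j: "j < L" "es' = rotate j es"
      by (auto simp: rotation_class_def L_def)
    have rot: "rotate ((m + j) mod L) es = rotate (m + j) es" for m
      by (simp add: rotate_conv_mod[of "m + j"] L_def)
    have wrap: "((m + i) mod L + i') mod L = m" if "m < L" "i + i' = L" for m i i'
    proof -
      have "((m + i) mod L + i') mod L = (m + (i + i')) mod L"
        by (simp only: mod_add_left_eq add.assoc)
      then show ?thesis using that by simp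
    qed
    have "bij_betw (\<lambda>m. (m + j) mod L) {m. m < L \<and> rotate m es = es} {m \<in> {..<L}. rotate m es = es'}"
    proof (rule bij_betw_byWitness[where f' = "\<lambda>m. (m + (L - j)) mod L"])
      show "\<forall>m\<in>{m. m < L \<and> rotate m es = es}. ((m + j) mod L + (L - j)) mod L = m"
        using j wrap[of _ j "L - j"] by simp
      show "\<forall>m\<in>{m \<in> {..<L}. rotate m es = es'}. ((m + (L - j)) mod L + j) mod L = m"
        using j wrap[of _ "L - j" j] by simp
      show "(\<lambda>m. (m + j) mod L) ` {m. m < L \<and> rotate m es = es} \<subseteq> {m \<in> {..<L}. rotate m es = es'}"
      proof (rule image_subsetI)
        fix m assume "m \<in> {m. m < L \<and> rotate m es = es}"
        then have "rotate (m + j) es = rotate j es"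
          using rotate_eq_rotate_iff[of m j es] by simp
        then show "(m + j) mod L \<in> {m \<in> {..<L}. rotate m es = es'}"
          using L j(2) rot[of m] by simp
      qed
      show "(\<lambda>m. (m + (L - j)) mod L) ` {m \<in> {..<L}. rotate m es = es'} \<subseteq> {m. m < L \<and> rotate m es = es}"
      proof (rule image_subsetI)
        fix m assume "m \<in> {m \<in> {..<L}. rotate m es = es'}"
        then have m: "m < L" "rotate m es = es'" by auto
        let ?m = "(m + (L - j)) mod L"
        have "rotate (?m + j) es = rotate ((?m + j) mod L) es"
          unfolding L_def by (rule rotate_conv_mod)
        also have "(?m + j) mod L = m" using m(1) j(1) wrap[of m "L - j" j] by simp
        finally have "rotate (?m + j) es = rotate j es" using m(2) j(2) by simp
        then have "rotate ?m es = es"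
          using rotate_eq_rotate_iff[of ?m j es] by blast
        then show "?m \<in> {m. m < L \<and> rotate m es = es}" using L by simp
      qed
    qed
    then show ?thesis by (simp add: bij_betw_same_card)
  qed
  have "L = card {..<L}" by simp
  also have "\<dots> = (\<Sum>es'\<in>rotation_class es. card {m \<in> {..<L}. rotate m es = es'})"
    by (simp only: card_eq_sum rotation_class_def L_def[symmetric])
       (rule sum.image_gen[OF finite_lessThan])
  also have "\<dots> = card (rotation_class es) * card {m. m < L \<and> rotate m es = es}"
    by (simp only: fiber sum_constant of_nat_id cong: sum.cong)
  finally show ?thesis by (simp add: L_def)
qed

context wf_digraph
begin

lemma closed_w_nonempty: "closed_w es \<Longrightarrow> es \<noteq> []"
  by (auto simp: closed_w_def)

lemma closed_w_rotate1:
  assumes "closed_w es" shows "closed_w (rotate1 es)"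
proof -
  from assms obtain u e es' where "es = e # es'" "awalk u (e # es') u"
    by (cases es) (auto simp: closed_w_def)
  then have "awalk (head G e) (es' @ [e]) (head G e)"
    by (auto simp: awalk_Cons_iff awalk_append_iff awalk_def[of _ "[]"])
  then show ?thesis using \<open>es = e # es'\<close> by (auto simp: closed_w_def)
qed

lemma closed_w_rotate: "closed_w es \<Longrightarrow> closed_w (rotate m es)"
  by (induction m) (auto intro: closed_w_rotate1)

lemma cyclic_perm_class:
  assumes "closed_w es"
  shows "cyclic_perm G `` {es} = rotation_class es"
proof -
  have "rotate m es \<in> rotation_class es" for m
    unfolding rotation_class_def using closed_w_nonempty[OF assms]
    by (subst rotate_conv_mod) auto
  then show ?thesis
    using assms by (auto simp: cyclic_perm_def rotation_class_def closed_w_rotate)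
qed

lemma equiv_cyclic_perm: "equiv {es. closed_w es} (cyclic_perm G)"
proof (rule equivI)
  show "cyclic_perm G \<subseteq> {es. closed_w es} \<times> {es. closed_w es}"
    by (auto simp: cyclic_perm_def)
  have "\<exists>m. es = rotate m es" for es :: "'b list" by (rule exI[of _ 0]) simp
  then show "refl_on {es. closed_w es} (cyclic_perm G)"
    by (auto simp: refl_on_def cyclic_perm_def)
  show "sym (cyclic_perm G)"
  proof (rule symI)
    fix es es' assume "(es, es') \<in> cyclic_perm G"
    then obtain m where m: "closed_w es" "closed_w es'" "es' = rotate m es"
      by (auto simp: cyclic_perm_def)
    have "rotate (length es - m mod length es) es' = es"
      using closed_w_nonempty[OF m(1)] unfolding m(3)
      by (subst (2) rotate_conv_mod) (simp add: rotate_rotate)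
    then have "\<exists>m. es = rotate m es'" by metis
    then show "(es', es) \<in> cyclic_perm G" using m by (simp add: cyclic_perm_def)
  qed
  show "trans (cyclic_perm G)"
    by (rule transI) (auto simp: cyclic_perm_def rotate_rotate)
qed

lemma cycle_representative:
  assumes "c \<in> cycles G"
  obtains es where "closed_w es" "c = rotation_class es" "es \<in> c"
proof -
  from assms obtain es where es: "closed_w es" "c = cyclic_perm G `` {es}"
    by (auto simp: cycles_def quotient_def)
  moreover have "es \<in> rotation_class es"
    unfolding rotation_class_def
    using closed_w_nonempty[OF es(1)] by (auto intro!: image_eqI[of _ _ 0])
  ultimately show thesis using that cyclic_perm_class by auto
qed

text \<open>
  Invariance under a single shift suffices to evaluate a function on a cycle at any
  representative; every quantity attached to a cycle is computed in this way.
\<close>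

lemma on_cycle_eq:
  assumes inv: "\<And>es. closed_w es \<Longrightarrow> f (rotate1 es) = f es"
    and "closed_w es"
  shows "on_cycle f (rotation_class es) = f es"
proof -
  have "f (rotate m es) = f es" for m
    by (induction m) (auto simp: inv closed_w_rotate assms(2))
  then have "f ` rotation_class es = {f es}"
    using closed_w_nonempty[OF assms(2)] by (force simp: rotation_class_def)
  then show ?thesis by (simp add: on_cycle_def)
qed

lemma cycle_length_eq: "closed_w es \<Longrightarrow> cycle_length (rotation_class es) = length es"
  unfolding cycle_length_def by (rule on_cycle_eq) auto

lemma cycle_val_eq:
  "closed_w es \<Longrightarrow> cycle_val (rotation_class es) = card {m. m < length es \<and> rotate m es = es}"
  unfolding cycle_val_def
proof (rule on_cycle_eq)
  fix es :: "'b list"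
  have "rotate m (rotate1 es) = rotate1 es \<longleftrightarrow> rotate m es = es" for m
  proof -
    have "rotate m (rotate1 es) = rotate1 (rotate m es)" by (simp add: rotate1_rotate_swap)
    then show ?thesis using rotate_inj[of 1 "rotate m es" es] by auto
  qed
  then show "card {m. m < length (rotate1 es) \<and> rotate m (rotate1 es) = rotate1 es}
      = card {m. m < length es \<and> rotate m es = es}" by simp
qed

lemma cycle_weight_eq: "closed_w es \<Longrightarrow> cycle_weight x (rotation_class es) = (\<Prod>e\<leftarrow>es. x e)"
  unfolding cycle_weight_def
proof (rule on_cycle_eq)
  show "(\<Prod>e\<leftarrow>rotate1 es. x e) = (\<Prod>e\<leftarrow>es. x e)" for es
    by (cases es) (auto simp: mult.commute)
qed

lemma cycle_visits_eq:
  "closed_w es \<Longrightarrow> cycle_visits G a (rotation_class es) = length (filter (\<lambda>e. tail G e = a) es)"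
proof -
  assume "closed_w es"
  then have "on_cycle (\<lambda>es. length (filter (\<lambda>e. tail G e = a) es)) (rotation_class es)
      = length (filter (\<lambda>e. tail G e = a) es)"
  proof (rule on_cycle_eq[rotated])
    show "length (filter (\<lambda>e. tail G e = a) (rotate1 es)) = length (filter (\<lambda>e. tail G e = a) es)" for es
      by (cases es) auto
  qed
  then show ?thesis by (simp add: cycle_visits_def length_filter_conv_card)
qed

lemma card_cycle_times_val:
  assumes "c \<in> cycles G"
  shows "card c * cycle_val c = cycle_length c" "cycle_length c > 0"
proof -
  obtain es where "closed_w es" "c = rotation_class es" using cycle_representative[OF assms] .
  then show "card c * cycle_val c = cycle_length c" "cycle_length c > 0"
    using card_rotation_class[of es] closed_w_nonempty[of es]
    by (auto simp: cycle_length_eq cycle_val_eq)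
qed

end

context fin_digraph
begin

lemma finite_closed_walks: "finite {es. closed_w es \<and> length es \<le> m}"
proof (rule finite_subset[OF _ finite_lists_length_le[OF finite_arcs]])
  show "{es. closed_w es \<and> length es \<le> m} \<subseteq> {es. set es \<subseteq> arcs G \<and> length es \<le> m}"
    by (auto simp: closed_w_def awalk_def)
qed

lemma finite_cycles_of_length: "finite {c \<in> cycles G. cycle_length c \<le> m}"
proof (rule finite_subset[OF _ finite_imageI[OF finite_closed_walks]])
  show "{c \<in> cycles G. cycle_length c \<le> m} \<subseteq> rotation_class ` {es. closed_w es \<and> length es \<le> m}"
  proof clarify
    fix c assume c: "c \<in> cycles G" "cycle_length c \<le> m"
    obtain es where "closed_w es" "c = rotation_class es" using cycle_representative[OF c(1)] .
    with c(2) show "c \<in> rotation_class ` {es. closed_w es \<and> length es \<le> m}"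
      by (auto simp: cycle_length_eq)
  qed
qed

text \<open>
  Group the closed walks by their rotation class. The factor \<open>card c\<close>, which is the length divided
  by the valuation, is where the valuations in the determinant formula come from.
\<close>

lemma sum_closed_walks_eq_sum_cycles:
  fixes f :: "'b list \<Rightarrow> 'c :: comm_semiring_1"
  assumes inv: "\<And>es. closed_w es \<Longrightarrow> f (rotate1 es) = f es"
  shows "(\<Sum>es\<in>{es. closed_w es \<and> length es = k}. f es)
    = (\<Sum>c\<in>{c \<in> cycles G. cycle_length c = k}. of_nat (card c) * on_cycle f c)"
proof -
  let ?W = "{es. closed_w es \<and> length es = k}"
  let ?C = "{c \<in> cycles G. cycle_length c = k}"
  have mem: "es \<in> rotation_class es" if "closed_w es" for es
    using closed_w_nonempty[OF that] by (auto simp: rotation_class_def intro!: image_eqI[of _ _ 0])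
  have cls: "{es' \<in> ?W. rotation_class es' = rotation_class es} = rotation_class es"
    if es: "es \<in> ?W" for es
  proof -
    have "es' \<in> ?W \<and> rotation_class es' = rotation_class es" if "es' \<in> rotation_class es" for es'
    proof -
      from that es have "(es, es') \<in> cyclic_perm G"
        by (auto simp: rotation_class_def cyclic_perm_def closed_w_rotate)
      then have "cyclic_perm G `` {es} = cyclic_perm G `` {es'}"
        by (rule equiv_class_eq[OF equiv_cyclic_perm])
      moreover have "closed_w es'" using \<open>(es, es') \<in> cyclic_perm G\<close> by (simp add: cyclic_perm_def)
      moreover have "length es' = length es" using that by (auto simp: rotation_class_def)
      ultimately show ?thesis using es by (simp add: cyclic_perm_class)
    qed
    moreover have "es' \<in> rotation_class es" if "es' \<in> ?W" "rotation_class es' = rotation_class es" for es'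
      using that mem[of es'] by simp
    ultimately show ?thesis by blast
  qed
  have image: "rotation_class ` ?W = ?C"
  proof -
    have "rotation_class es \<in> cycles G" if "closed_w es" for es
      using that cyclic_perm_class[OF that] quotientI[of es "{es. closed_w es}" "cyclic_perm G"]
      by (simp add: cycles_def)
    moreover have "c \<in> rotation_class ` ?W" if c: "c \<in> ?C" for c
    proof -
      obtain es where es: "closed_w es" "c = rotation_class es" using cycle_representative[of c] c by blast
      then have "es \<in> ?W" using c by (simp add: cycle_length_eq)
      then show ?thesis using es(2) by blast
    qed
    ultimately show ?thesis by (auto simp: cycle_length_eq)
  qed
  have "(\<Sum>es\<in>?W. f es) = (\<Sum>c\<in>rotation_class ` ?W. \<Sum>es\<in>{es \<in> ?W. rotation_class es = c}. f es)"
    by (rule sum.image_gen) (rule finite_subset[OF _ finite_closed_walks[of k]], auto)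
  also have "\<dots> = (\<Sum>c\<in>?C. of_nat (card c) * on_cycle f c)"
    unfolding image
  proof (rule sum.cong[OF refl])
    fix c assume "c \<in> ?C"
    then obtain es where es: "es \<in> ?W" "c = rotation_class es" unfolding image[symmetric] by blast
    have "(\<Sum>es'\<in>rotation_class es. f es') = (\<Sum>es'\<in>rotation_class es. f es)"
    proof (rule sum.cong[OF refl])
      fix es' assume "es' \<in> rotation_class es"
      then obtain m where "es' = rotate m es" by (auto simp: rotation_class_def)
      moreover have "f (rotate m es) = f es" using es(1)
        by (induction m) (auto simp: inv closed_w_rotate)
      ultimately show "f es' = f es" by simp
    qed
    then show "(\<Sum>es\<in>{es \<in> ?W. rotation_class es = c}. f es) = of_nat (card c) * on_cycle f c"
      using es on_cycle_eq[where f = f, OF inv, of es] cls[OF es(1)] by simp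
  qed
  finally show ?thesis .
qed

end

section \<open>Matrices indexed by a list and walk expansions\<close>

text \<open>
  Matrices are handled through kernels on the index set itself, so that block structure is just
  dependence on the first component of an index, and sums over positions become sums over \<open>set bs\<close>.
\<close>

definition kernel_mat :: "'b list \<Rightarrow> ('b \<Rightarrow> 'b \<Rightarrow> 'c) \<Rightarrow> 'c mat" where
  "kernel_mat bs K = mat (length bs) (length bs) (\<lambda>(i, j). K (bs ! i) (bs ! j))"

lemma kernel_mat_carrier [simp]: "kernel_mat bs K \<in> carrier_mat (length bs) (length bs)"
  by (simp add: kernel_mat_def)

lemma kernel_mat_cong:
  "(\<And>b c. b \<in> set bs \<Longrightarrow> c \<in> set bs \<Longrightarrow> K b c = L b c) \<Longrightarrow> kernel_mat bs K = kernel_mat bs L"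
  by (rule eq_matI) (auto simp: kernel_mat_def)

lemma one_mat_eq_kernel_mat:
  "distinct bs \<Longrightarrow> 1\<^sub>m (length bs) = kernel_mat bs (\<lambda>b c. if b = c then 1 else 0)"
  by (rule eq_matI) (auto simp: kernel_mat_def nth_eq_iff_index_eq)

lemma sum_nth_distinct:
  "distinct bs \<Longrightarrow> (\<Sum>i<length bs. f (bs ! i)) = (\<Sum>b\<in>set bs. f b)"
  by (rule sum.reindex_bij_betw[OF bij_betw_nth]) auto

lemma kernel_mat_mult:
  fixes K :: "'b \<Rightarrow> 'b \<Rightarrow> 'c :: semiring_0"
  assumes "distinct bs"
  shows "kernel_mat bs K * kernel_mat bs L = kernel_mat bs (\<lambda>b d. \<Sum>c\<in>set bs. K b c * L c d)"
  by (rule eq_matI)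
     (auto simp: kernel_mat_def scalar_prod_def sum_nth_distinct[OF assms, symmetric] lessThan_atLeast0
       intro!: sum.cong)

lemma mat_trace_kernel_mat:
  "distinct bs \<Longrightarrow> mat_trace (kernel_mat bs K) = (\<Sum>b\<in>set bs. K b b)"
  by (simp add: mat_trace_def kernel_mat_def sum_nth_distinct[where f = "\<lambda>b. K b b"])

lemma pow_mat_Suc_left:
  assumes "(A :: 'a :: semiring_1 mat) \<in> carrier_mat n n"
  shows "A ^\<^sub>m Suc k = A * A ^\<^sub>m k"
proof (induction k)
  case (Suc k)
  have "A ^\<^sub>m Suc (Suc k) = (A * A ^\<^sub>m k) * A" using Suc by simp
  also have "\<dots> = A * (A ^\<^sub>m k * A)"
    by (rule assoc_mult_mat) (use assms in auto)
  finally show ?case by simp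
qed (use assms in auto)

text \<open>
  The holonomy of a walk ending at \<open>v\<close>. Naming the end point, rather than reading off the starting
  point of the first edge, gives the empty walk a holonomy and so starts the induction on
  length.
\<close>

definition open_hol :: "('v \<Rightarrow> nat) \<Rightarrow> ('e \<Rightarrow> complex mat) \<Rightarrow> 'v \<Rightarrow> 'e list \<Rightarrow> complex mat" where
  "open_hol n U v es = foldr (*) (map U es) (1\<^sub>m (n v))"

lemma open_hol_simps [simp]:
  "open_hol n U v [] = 1\<^sub>m (n v)"
  "open_hol n U v (e # es) = U e * open_hol n U v es"
  by (simp_all add: open_hol_def)

text \<open>
  The block of \<open>(u, v)\<close> is the sum of \<open>w e * U e\<close> over the edges from \<open>u\<close> to \<open>v\<close>: the weighted adjacency
  matrix twisted by the connection.
\<close>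

definition transport_kernel ::
  "('v, 'e) pre_digraph \<Rightarrow> ('e \<Rightarrow> complex) \<Rightarrow> ('e \<Rightarrow> complex mat) \<Rightarrow> 'v \<times> nat \<Rightarrow> 'v \<times> nat \<Rightarrow> complex"
where
  "transport_kernel G w U b c =
     (\<Sum>e\<in>{e \<in> out_arcs G (fst b). head G e = fst c}. w e * U e $$ (snd b, snd c))"

context fin_digraph
begin

lemma open_hol_carrier:
  assumes U: "\<forall>e\<in>arcs G. U e \<in> carrier_mat (n (tail G e)) (n (head G e))"
    and "awalk u es v"
  shows "open_hol n U v es \<in> carrier_mat (n u) (n v)"
  using assms(2)
proof (induction es arbitrary: u)
  case (Cons e es)
  then have "e \<in> arcs G" "tail G e = u" "awalk (head G e) es v" by (auto simp: awalk_Cons_iff)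
  with Cons.IH[of "head G e"] U show ?case by auto
qed (auto simp: awalk_Nil_iff)

lemma finite_walks: "finite {es. awalk u es v \<and> length es = k}"
  by (rule finite_subset[OF _ finite_lists_length_le[OF finite_arcs, of k]])
     (auto simp: awalk_def)

text \<open>
  Transfer matrix method: powers of the twisted adjacency matrix enumerate walks, each with the
  matrix entry of its holonomy.
\<close>

lemma kernel_mat_pow:
  fixes U :: "'b \<Rightarrow> complex mat"
  assumes U: "\<forall>e\<in>arcs G. U e \<in> carrier_mat (n (tail G e)) (n (head G e))"
    and bs: "distinct bs" "set bs = Sigma (verts G) (\<lambda>v. {..<n v})"
  shows "kernel_mat bs (transport_kernel G w U) ^\<^sub>m k = kernel_mat bs (\<lambda>b c.
    \<Sum>es\<in>{es. awalk (fst b) es (fst c) \<and> length es = k}.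
      (\<Prod>e\<leftarrow>es. w e) * open_hol n U (fst c) es $$ (snd b, snd c))"
proof (induction k)
  case 0
  have base: "(\<Sum>es\<in>{es. awalk (fst b) es (fst c) \<and> length es = 0}.
      (\<Prod>e\<leftarrow>es. w e) * open_hol n U (fst c) es $$ (snd b, snd c)) = (if b = c then 1 else 0)"
    if b: "b \<in> set bs" and c: "c \<in> set bs" for b c
  proof -
    obtain u i v l where bc: "b = (u, i)" "c = (v, l)" by (cases b, cases c)
    have u: "u \<in> verts G" "i < n u" "l < n v" using b c unfolding bs(2) bc by auto
    have "{es. awalk u es v \<and> length es = 0} = (if u = v then {[]} else {})"
      using u(1) by (auto simp: awalk_Nil_iff)
    then show ?thesis using u by (cases "u = v") (simp_all add: bc)
  qed
  have "kernel_mat bs (transport_kernel G w U) ^\<^sub>m 0 = 1\<^sub>m (length bs)"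
    by (simp add: kernel_mat_def)
  also have "\<dots> = kernel_mat bs (\<lambda>b c. if b = c then 1 else 0)"
    by (rule one_mat_eq_kernel_mat[OF bs(1)])
  finally show ?case by (subst kernel_mat_cong[OF base]) simp_all
next
  case (Suc k)
  let ?W = "\<lambda>u v k. {es. awalk u es v \<and> length es = k}"
  let ?t = "\<lambda>v es i l. (\<Prod>e\<leftarrow>es. w e) * open_hol n U v es $$ (i, l)"
  have step: "(\<Sum>d\<in>set bs. transport_kernel G w U b d * (\<Sum>es\<in>?W (fst d) (fst c) k. ?t (fst c) es (snd d) (snd c)))
      = (\<Sum>es\<in>?W (fst b) (fst c) (Suc k). ?t (fst c) es (snd b) (snd c))"
    if b: "b \<in> set bs" and c: "c \<in> set bs" for b c
  proof -
    obtain u i v l where bc: "b = (u, i)" "c = (v, l)" by (cases b, cases c)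
    have u: "u \<in> verts G" "i < n u" "l < n v" using b c unfolding bs(2) bc by auto
    let ?S = "\<lambda>u' j. \<Sum>es\<in>?W u' v k. ?t v es j l"
    have "(\<Sum>d\<in>set bs. transport_kernel G w U b d * (\<Sum>es\<in>?W (fst d) (fst c) k. ?t (fst c) es (snd d) (snd c)))
        = (\<Sum>u'\<in>verts G. \<Sum>j<n u'. \<Sum>e\<in>{e \<in> out_arcs G u. head G e = u'}. w e * U e $$ (i, j) * ?S u' j)"
      unfolding bs(2) bc transport_kernel_def
      by (subst sum.Sigma) (auto simp: sum_distrib_right intro!: sum.cong)
    also have "\<dots> = (\<Sum>u'\<in>verts G. \<Sum>e\<in>{e \<in> out_arcs G u. head G e = u'}.
        \<Sum>j<n (head G e). w e * U e $$ (i, j) * ?S (head G e) j)"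
      by (rule sum.cong[OF refl], subst sum.swap) (auto intro!: sum.cong)
    \<comment> \<open>Summing over the intermediate vertex and then over the edges leading to it is summing over all first edges.\<close>
    also have "\<dots> = (\<Sum>e\<in>out_arcs G u. \<Sum>j<n (head G e). w e * U e $$ (i, j) * ?S (head G e) j)"
      by (rule sum.group) auto
    also have "\<dots> = (\<Sum>e\<in>out_arcs G u. \<Sum>es\<in>?W (head G e) v k. ?t v (e # es) i l)"
    proof (rule sum.cong[OF refl])
      fix e assume e: "e \<in> out_arcs G u"
      then have Ue: "U e \<in> carrier_mat (n u) (n (head G e))" using U by auto
      have "(\<Sum>j<n (head G e). w e * U e $$ (i, j) * ?S (head G e) j)
          = (\<Sum>es\<in>?W (head G e) v k. w e * (\<Prod>e\<leftarrow>es. w e)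
              * (\<Sum>j<n (head G e). U e $$ (i, j) * open_hol n U v es $$ (j, l)))"
        unfolding sum_distrib_left by (subst sum.swap) (simp add: ac_simps)
      also have "\<dots> = (\<Sum>es\<in>?W (head G e) v k. ?t v (e # es) i l)"
      proof (rule sum.cong[OF refl])
        fix es assume "es \<in> ?W (head G e) v k"
        then have "open_hol n U v es \<in> carrier_mat (n (head G e)) (n v)"
          using open_hol_carrier[OF U] by blast
        with Ue u show "w e * (\<Prod>e\<leftarrow>es. w e)
              * (\<Sum>j<n (head G e). U e $$ (i, j) * open_hol n U v es $$ (j, l)) = ?t v (e # es) i l"
          by (auto simp: scalar_prod_def lessThan_atLeast0)
      qed
      finally show "(\<Sum>j<n (head G e). w e * U e $$ (i, j) * ?S (head G e) j)
          = (\<Sum>es\<in>?W (head G e) v k. ?t v (e # es) i l)" .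
    qed
    also have "\<dots> = (\<Sum>(e, es)\<in>Sigma (out_arcs G u) (\<lambda>e. ?W (head G e) v k). ?t v (e # es) i l)"
      by (rule sum.Sigma) (auto simp: finite_walks)
    also have "\<dots> = (\<Sum>es\<in>?W u v (Suc k). ?t v es i l)"
    proof (rule sum.reindex_bij_witness[where i = "\<lambda>es. (hd es, tl es)" and j = "\<lambda>(e, es). e # es"])
      fix es assume "es \<in> ?W u v (Suc k)"
      then show "(case (hd es, tl es) of (e, es) \<Rightarrow> e # es) = es"
        "(hd es, tl es) \<in> Sigma (out_arcs G u) (\<lambda>e. ?W (head G e) v k)"
        by (cases es; auto simp: awalk_Cons_iff)+
    qed (use u in \<open>auto simp: awalk_Cons_iff\<close>)
    finally show ?thesis by (simp add: bc)
  qed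
  have "kernel_mat bs (transport_kernel G w U) ^\<^sub>m Suc k = kernel_mat bs (transport_kernel G w U) *
      kernel_mat bs (\<lambda>b c. \<Sum>es\<in>?W (fst b) (fst c) k. ?t (fst c) es (snd b) (snd c))"
    by (subst pow_mat_Suc_left[OF kernel_mat_carrier], subst Suc.IH) simp
  also have "\<dots> = kernel_mat bs (\<lambda>b c. \<Sum>d\<in>set bs. transport_kernel G w U b d *
      (\<Sum>es\<in>?W (fst d) (fst c) k. ?t (fst c) es (snd d) (snd c)))"
    by (rule kernel_mat_mult[OF bs(1)])
  also have "\<dots> = kernel_mat bs (\<lambda>b c. \<Sum>es\<in>?W (fst b) (fst c) (Suc k). ?t (fst c) es (snd b) (snd c))"
    by (rule kernel_mat_cong[OF step])
  finally show ?case .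
qed

lemma trace_kernel_mat_pow:
  fixes U :: "'b \<Rightarrow> complex mat"
  assumes U: "\<forall>e\<in>arcs G. U e \<in> carrier_mat (n (tail G e)) (n (head G e))"
    and bs: "distinct bs" "set bs = Sigma (verts G) (\<lambda>v. {..<n v})" and k: "k > 0"
  shows "mat_trace (kernel_mat bs (transport_kernel G w U) ^\<^sub>m k)
    = (\<Sum>es\<in>{es. closed_w es \<and> length es = k}. (\<Prod>e\<leftarrow>es. w e) * mat_trace (walk_hol G n U es))"
proof -
  let ?W = "\<lambda>v. {es. awalk v es v \<and> length es = k}"
  have start: "tail G (hd es) = v" if "es \<in> ?W v" for es v
    using that k by (cases es) (auto simp: awalk_Cons_iff)
  have "mat_trace (kernel_mat bs (transport_kernel G w U) ^\<^sub>m k)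
      = (\<Sum>v\<in>verts G. \<Sum>i<n v. \<Sum>es\<in>?W v. (\<Prod>e\<leftarrow>es. w e) * open_hol n U v es $$ (i, i))"
    unfolding kernel_mat_pow[OF U bs] mat_trace_kernel_mat[OF bs(1)] bs(2)
    by (subst sum.Sigma) (auto intro!: sum.cong)
  also have "\<dots> = (\<Sum>v\<in>verts G. \<Sum>es\<in>?W v. (\<Prod>e\<leftarrow>es. w e) * mat_trace (walk_hol G n U es))"
  proof (rule sum.cong[OF refl], subst sum.swap, rule sum.cong[OF refl])
    fix v es assume es: "es \<in> ?W v"
    then have "open_hol n U v es \<in> carrier_mat (n v) (n v)"
      using open_hol_carrier[OF U] by blast
    moreover have "walk_hol G n U es = open_hol n U v es"
      using start[OF es] by (simp add: walk_hol_def open_hol_def)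
    ultimately show "(\<Sum>i<n v. (\<Prod>e\<leftarrow>es. w e) * open_hol n U v es $$ (i, i))
        = (\<Prod>e\<leftarrow>es. w e) * mat_trace (walk_hol G n U es)"
      by (simp add: mat_trace_def sum_distrib_left)
  qed
  also have "\<dots> = (\<Sum>es\<in>(\<Union>v\<in>verts G. ?W v). (\<Prod>e\<leftarrow>es. w e) * mat_trace (walk_hol G n U es))"
  proof (rule sum.UNION_disjoint[symmetric])
    show "\<forall>v\<in>verts G. \<forall>u\<in>verts G. v \<noteq> u \<longrightarrow> ?W v \<inter> ?W u = {}" using start by blast
  qed (simp_all add: finite_walks)
  also have "(\<Union>v\<in>verts G. ?W v) = {es. closed_w es \<and> length es = k}"
    using k by (auto simp: closed_w_def dest: awalk_hd_in_verts)
  finally show ?thesis .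
qed

text \<open>
  Moving the first edge to the end turns \<open>U e * H\<close> into \<open>H * U e\<close>, and these have the same trace.
\<close>

lemma mat_trace_walk_hol_rotate1:
  fixes U :: "'b \<Rightarrow> complex mat"
  assumes U: "\<forall>e\<in>arcs G. U e \<in> carrier_mat (n (tail G e)) (n (head G e))"
    and "closed_w es"
  shows "mat_trace (walk_hol G n U (rotate1 es)) = mat_trace (walk_hol G n U es)"
proof -
  obtain u e es' where es: "es = e # es'" "awalk u (e # es') u"
    using assms(2) by (cases es) (auto simp: closed_w_def)
  then have e: "e \<in> arcs G" "tail G e = u" "awalk (head G e) es' u" by (auto simp: awalk_Cons_iff)
  let ?v = "head G e"
  have H: "open_hol n U u es' \<in> carrier_mat (n ?v) (n u)" by (rule open_hol_carrier[OF U e(3)])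
  have Ue: "U e \<in> carrier_mat (n u) (n ?v)" using bspec[OF U e(1)] e(2) by simp
  have snoc: "open_hol n U ?v (fs @ [e]) = open_hol n U u fs * U e" if "awalk v fs u" for v fs
    using that
  proof (induction fs arbitrary: v)
    case Nil
    then show ?case using Ue by (auto simp: awalk_Nil_iff)
  next
    case (Cons f fs)
    then have f: "f \<in> arcs G" "awalk (head G f) fs u" by (auto simp: awalk_Cons_iff)
    show ?case
      using Cons.IH[OF f(2)] assoc_mult_mat[OF bspec[OF U f(1)] open_hol_carrier[OF U f(2)] Ue] by simp
  qed
  have "tail G (hd (es' @ [e])) = ?v" using e by (cases es') (auto simp: awalk_simps)
  then have "walk_hol G n U (rotate1 es) = open_hol n U u es' * U e"
    using snoc[OF e(3)] es(1) by (simp add: walk_hol_def open_hol_def)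
  moreover have "walk_hol G n U es = U e * open_hol n U u es'"
    using es(1) e(2) by (simp add: walk_hol_def open_hol_def)
  ultimately show ?thesis using mat_trace_mult_commute[OF H Ue] by simp
qed

lemma prod_list_vertex_weight:
  assumes "set es \<subseteq> arcs G"
  shows "(\<Prod>e\<leftarrow>es. y (tail G e) :: 'c :: comm_semiring_1)
    = (\<Prod>a\<in>verts G. y a ^ length (filter (\<lambda>e. tail G e = a) es))"
  using assms
proof (induction es)
  case (Cons e es)
  have "(\<Prod>a\<in>verts G. y a ^ length (filter (\<lambda>f. tail G f = a) (e # es)))
      = (\<Prod>a\<in>verts G. (if a = tail G e then y a else 1) * y a ^ length (filter (\<lambda>f. tail G f = a) es))"
    by (rule prod.cong) auto
  also have "\<dots> = y (tail G e) * (\<Prod>a\<in>verts G. y a ^ length (filter (\<lambda>f. tail G f = a) es))"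
    using Cons.prems by (simp add: prod.distrib)
  finally show ?case using Cons by simp
qed simp

lemma sum_length_filter_tail:
  assumes "set es \<subseteq> arcs G"
  shows "(\<Sum>a\<in>verts G. length (filter (\<lambda>e. tail G e = a) es)) = length es"
  using assms
proof (induction es)
  case (Cons e es)
  have "(\<Sum>a\<in>verts G. length (filter (\<lambda>f. tail G f = a) (e # es)))
      = (\<Sum>a\<in>verts G. (if a = tail G e then 1 else 0) + length (filter (\<lambda>f. tail G f = a) es))"
    by (rule sum.cong) auto
  also have "\<dots> = 1 + (\<Sum>a\<in>verts G. length (filter (\<lambda>f. tail G f = a) es))"
    using Cons.prems by (simp add: sum.distrib)
  finally show ?case using Cons by simp
qed simp

lemma sum_cycle_visits: "c \<in> cycles G \<Longrightarrow> (\<Sum>a\<in>verts G. cycle_visits G a c) = cycle_length c"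
proof (erule cycle_representative)
  fix es assume es: "closed_w es" "c = rotation_class es"
  then have "set es \<subseteq> arcs G" by (auto simp: closed_w_def awalk_def)
  from sum_length_filter_tail[OF this] show ?thesis
    using es by (simp add: cycle_visits_eq cycle_length_eq)
qed

text \<open>
  The contribution of a cycle to the formula; together the valuation and the sign turn the traces
  of powers into the exponent of det(1 - A).
\<close>

definition cycle_term :: "('b \<Rightarrow> complex) \<Rightarrow> ('a \<Rightarrow> nat) \<Rightarrow> ('b \<Rightarrow> complex mat) \<Rightarrow> 'b list set \<Rightarrow> complex" where
  "cycle_term x n U c = cycle_weight x c * (- cycle_tr_hol G n U c / of_nat (cycle_val c))"

text \<open>
  The vertex variables \<open>y\<close> multiply the rows of the matrix, so \<open>y a\<close> occurs once for every visit to
  \<open>a\<close>. The bound on the total length is still cruder than the bounds vertex by vertex.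
\<close>

lemma det_one_minus_transport:
  fixes U :: "'b \<Rightarrow> complex mat" and y :: "'a \<Rightarrow> complex"
  assumes U: "\<forall>e\<in>arcs G. U e \<in> carrier_mat (n (tail G e)) (n (head G e))"
    and bs: "distinct bs" "set bs = Sigma (verts G) (\<lambda>v. {..<n v})"
  shows "det (1\<^sub>m (length bs) - kernel_mat bs (transport_kernel G (\<lambda>e. y (tail G e) * x e) U))
    = (\<Sum>C\<in>{C \<in> cycle_multisets G. (\<Sum>c\<in>#C. cycle_length c) \<le> length bs}.
        (\<Prod>a\<in>verts G. y a ^ mset_visits G a C) * mset_term (cycle_term x n U) C)"
proof -
  let ?w = "\<lambda>e. y (tail G e) * x e"
  let ?g = "\<lambda>c. (\<Prod>a\<in>verts G. y a ^ cycle_visits G a c) * cycle_term x n U c"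
  let ?f = "\<lambda>es. (\<Prod>e\<leftarrow>es. ?w e) * mat_trace (walk_hol G n U es)"
  have inv: "?f (rotate1 es) = ?f es" if "closed_w es" for es
    using mat_trace_walk_hol_rotate1[OF U that] by (cases es) (auto simp: ac_simps)
  \<comment> \<open>Since the class has length / valuation elements, its closed walks together contribute minus the length times the weight.\<close>
  have f: "of_nat (card c) * on_cycle ?f c = - (of_nat (cycle_length c) * ?g c)" if c: "c \<in> cycles G" for c
  proof -
    obtain es where es: "closed_w es" "c = rotation_class es" using cycle_representative[OF c] .
    have arcs: "set es \<subseteq> arcs G" using es(1) by (auto simp: closed_w_def awalk_def)
    have tr: "cycle_tr_hol G n U c = mat_trace (walk_hol G n U es)"
      unfolding cycle_tr_hol_def es(2)
      by (rule on_cycle_eq[where f = "\<lambda>es. mat_trace (walk_hol G n U es)", OF mat_trace_walk_hol_rotate1[OF U] es(1)])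
    have weight_split: "(\<Prod>e\<leftarrow>fs. ?w e) = (\<Prod>e\<leftarrow>fs. y (tail G e)) * (\<Prod>e\<leftarrow>fs. x e)" for fs
      by (induction fs) (simp_all add: ac_simps)
    have "on_cycle ?f c = ?f es" unfolding es(2) by (rule on_cycle_eq[where f = ?f, OF inv es(1)])
    also have "\<dots> = (\<Prod>a\<in>verts G. y a ^ cycle_visits G a c) * cycle_weight x c * cycle_tr_hol G n U c"
      using tr unfolding es(2) cycle_visits_eq[OF es(1)] cycle_weight_eq[OF es(1)]
        prod_list_vertex_weight[OF arcs, symmetric]
      unfolding weight_split by simp
    finally have on: "on_cycle ?f c = \<dots>" .
    have "of_nat (card c) * (of_nat (cycle_val c) :: complex) = of_nat (cycle_length c)"
      using card_cycle_times_val(1)[OF c] by (metis of_nat_mult)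
    moreover have "of_nat (cycle_val c) \<noteq> (0 :: complex)"
      using card_cycle_times_val[OF c] by (metis mult_0_right not_gr_zero of_nat_0_eq_iff)
    ultimately have "of_nat (card c) = (of_nat (cycle_length c) / of_nat (cycle_val c) :: complex)"
      by (simp add: field_simps)
    then show ?thesis by (simp add: on cycle_term_def)
  qed
  have visits_term: "mset_term ?g C = (\<Prod>a\<in>verts G. y a ^ mset_visits G a C) * mset_term (cycle_term x n U) C" for C
  proof -
    have "(\<Prod>c\<in>#C. ?g c) = (\<Prod>a\<in>verts G. y a ^ mset_visits G a C) * (\<Prod>c\<in>#C. cycle_term x n U c)"
      by (induction C) (auto simp: mset_visits_def power_add prod.distrib ac_simps)
    then show ?thesis by (simp add: mset_term_def)
  qed
  have "det (1\<^sub>m (length bs) - kernel_mat bs (transport_kernel G ?w U))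
      = (\<Sum>C\<in>{C. set_mset C \<subseteq> cycles G \<and> (\<Sum>c\<in>#C. cycle_length c) \<le> length bs}. mset_term ?g C)"
  proof (rule det_one_minus_eq_sum_msets[OF kernel_mat_carrier _ finite_cycles_of_length])
    fix k :: nat assume k: "k > 0"
    have "mat_trace (kernel_mat bs (transport_kernel G ?w U) ^\<^sub>m k)
        = (\<Sum>es\<in>{es. closed_w es \<and> length es = k}. ?f es)"
      by (rule trace_kernel_mat_pow[OF U bs k])
    also have "\<dots> = (\<Sum>c\<in>{c \<in> cycles G. cycle_length c = k}. of_nat (card c) * on_cycle ?f c)"
      by (rule sum_closed_walks_eq_sum_cycles[where f = ?f, OF inv])
    also have "\<dots> = (\<Sum>c\<in>{c \<in> cycles G. cycle_length c = k}. - (of_nat k * ?g c))"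
      by (rule sum.cong) (auto simp: f)
    finally show "mat_trace (kernel_mat bs (transport_kernel G ?w U) ^\<^sub>m k)
        = - (\<Sum>c\<in>{c \<in> cycles G. cycle_length c = k}. of_nat k * ?g c)"
      by (simp add: sum_negf)
  qed (use card_cycle_times_val in auto)
  then show ?thesis by (simp add: visits_term cycle_multisets_def)
qed

end

section \<open>Discarding the terms of too high degree\<close>

text \<open>
  Both sides are polynomials in \<open>s\<close>, and the field is infinite, so the terms of each degree above
  \<open>n\<close> cancel among themselves and may be dropped.
\<close>

lemma poly_eq_truncated_sum:
  fixes p :: "'a :: field_char_0 poly"
  assumes "finite F" and deg: "degree p \<le> n"
    and eq: "\<And>s. poly p s = (\<Sum>C\<in>F. c C * s ^ v C)"
  shows "poly p s = (\<Sum>C\<in>{C \<in> F. v C \<le> n}. c C * s ^ v C)"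
proof -
  have "p = (\<Sum>C\<in>F. monom (c C) (v C))"
    unfolding poly_eq_poly_eq_iff[symmetric] by (rule ext) (simp add: eq poly_sum poly_monom)
  then have coeff: "coeff p m = (\<Sum>C\<in>F. if v C = m then c C else 0)" for m
    by (simp add: coeff_sum)
  have coeff': "coeff p m = (\<Sum>C\<in>{C \<in> F. v C = m}. c C)" for m
    unfolding coeff by (rule sum.inter_filter[OF \<open>finite F\<close>, symmetric])
  have "poly p s = (\<Sum>m\<le>n. coeff p m * s ^ m)"
    using deg by (subst poly_altdef) (auto intro!: sum.mono_neutral_left le_degree)
  also have "\<dots> = (\<Sum>m\<le>n. \<Sum>C\<in>{C \<in> {C \<in> F. v C \<le> n}. v C = m}. c C * s ^ v C)"
    unfolding coeff' sum_distrib_right by (intro sum.cong) auto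
  also have "\<dots> = (\<Sum>C\<in>{C \<in> F. v C \<le> n}. c C * s ^ v C)"
    by (rule sum.group) (use \<open>finite F\<close> in auto)
  finally show ?thesis .
qed

lemma degree_det_le_row_degrees:
  fixes A :: "'a :: comm_ring_1 poly mat"
  assumes A: "A \<in> carrier_mat N N"
    and row: "\<And>i j. i < N \<Longrightarrow> j < N \<Longrightarrow> degree (A $$ (i, j)) \<le> r i"
  shows "degree (det A) \<le> (\<Sum>i<N. r i)"
  unfolding det_def'[OF A]
proof (rule degree_sum_le)
  show "finite {q. q permutes {0..<N}}" by (simp add: finite_permutations)
  fix q assume "q \<in> {q. q permutes {0..<N}}"
  then have q: "q i < N" if "i < N" for i using permutes_in_image[of q "{0..<N}" i] that by auto
  have "degree (signof q * (\<Prod>i = 0..<N. A $$ (i, q i))) \<le> degree (\<Prod>i = 0..<N. A $$ (i, q i))"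
    by (simp add: sign_def)
  also have "\<dots> \<le> (\<Sum>i = 0..<N. degree (A $$ (i, q i)))"
    using degree_prod_sum_le[of "{0..<N}" "\<lambda>i. A $$ (i, q i)"] by (simp add: o_def)
  also have "\<dots> \<le> (\<Sum>i = 0..<N. r i)"
    by (rule sum_mono) (use row q in auto)
  finally show "degree (signof q * (\<Prod>i = 0..<N. A $$ (i, q i))) \<le> (\<Sum>i<N. r i)"
    by (simp add: atLeast0LessThan)
qed

lemma sum_Sigma_fst_indicator:
  assumes "finite V" "a \<in> V"
  shows "(\<Sum>b\<in>Sigma V (\<lambda>v. {..<n v}). if fst b = a then 1 else 0 :: nat) = n a"
proof -
  have "(\<Sum>b\<in>Sigma V (\<lambda>v. {..<n v}). if fst b = a then 1 else 0 :: nat)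
      = (\<Sum>v\<in>V. \<Sum>i<n v. if v = a then 1 else 0)"
    using assms(1) by (subst sum.Sigma) (auto intro!: sum.cong)
  also have "\<dots> = (\<Sum>v\<in>V. if v = a then n a else 0)"
    by (rule sum.cong) auto
  finally show ?thesis using assms by simp
qed

lemma transport_kernel_vertex_weight:
  "transport_kernel G (\<lambda>e. y (tail G e) * x e) U b c = y (fst b) * transport_kernel G x U b c"
  by (auto simp: transport_kernel_def sum_distrib_left mult.assoc intro!: sum.cong)

context fin_digraph
begin

lemma length_coords:
  assumes "distinct bs" "set bs = Sigma (verts G) (\<lambda>v. {..<n v})"
  shows "length bs = (\<Sum>v\<in>verts G. n v)"
  using distinct_card[OF assms(1)] assms(2) by simp

lemma sum_mset_cycle_length:
  "C \<in> cycle_multisets G \<Longrightarrow> (\<Sum>c\<in>#C. cycle_length c) = (\<Sum>a\<in>verts G. mset_visits G a C)"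
proof (induction C)
  case (add c C)
  then have "c \<in> cycles G" "C \<in> cycle_multisets G" by (auto simp: cycle_multisets_def)
  with add.IH show ?case
    by (simp add: mset_visits_def sum.distrib sum_cycle_visits)
qed (simp add: mset_visits_def)

lemma finite_short_cycle_multisets:
  "finite {C \<in> cycle_multisets G. (\<Sum>c\<in>#C. cycle_length c) \<le> N}"
proof -
  have "{C \<in> cycle_multisets G. (\<Sum>c\<in>#C. cycle_length c) \<le> N}
      = (\<Union>m\<le>N. msets_of_length (cycles G) cycle_length m)"
    by (auto simp: msets_of_length_def cycle_multisets_def)
  then show ?thesis
    using finite_msets_of_length[of "cycles G" cycle_length] card_cycle_times_val(2)
      finite_cycles_of_length by simp
qed

text \<open>
  The multisets whose terms survive the degree bounds.
\<close>

definition bounded_multisets :: "('a \<Rightarrow> nat) \<Rightarrow> 'b list set multiset set" where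
  "bounded_multisets n = {C \<in> cycle_multisets G. \<forall>a\<in>verts G. mset_visits G a C \<le> n a}"

lemma bounded_multisets_short:
  "C \<in> bounded_multisets n \<Longrightarrow> (\<Sum>c\<in>#C. cycle_length c) \<le> (\<Sum>a\<in>verts G. n a)"
  by (auto simp: bounded_multisets_def sum_mset_cycle_length intro: sum_mono)

lemma finite_bounded_multisets: "finite (bounded_multisets n)"
  by (rule finite_subset[OF _ finite_short_cycle_multisets[of "\<Sum>a\<in>verts G. n a"]])
     (use bounded_multisets_short in \<open>auto simp: bounded_multisets_def\<close>)

text \<open>
  The variable \<open>y a\<close> occurs only in the \<open>n a\<close> rows that belong to the vertex \<open>a\<close>, and linearly in
  each of them.
\<close>

lemma det_one_minus_transport_poly:
  fixes U :: "'b \<Rightarrow> complex mat" and y :: "'a \<Rightarrow> complex"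
  assumes bs: "distinct bs" "set bs = Sigma (verts G) (\<lambda>v. {..<n v})" and a: "a \<in> verts G"
  obtains P where "degree P \<le> n a"
    "\<And>s. poly P s = det (1\<^sub>m (length bs) - kernel_mat bs (transport_kernel G (\<lambda>e. (y(a := s)) (tail G e) * x e) U))"
proof -
  let ?N = "length bs"
  let ?T = "transport_kernel G x U"
  define A where "A = mat ?N ?N (\<lambda>(i, j). [:if i = j then 1 else 0:]
    - (if fst (bs ! i) = a then [:0, ?T (bs ! i) (bs ! j):] else [:y (fst (bs ! i)) * ?T (bs ! i) (bs ! j):]))"
  have A: "A \<in> carrier_mat ?N ?N" by (simp add: A_def)
  have "degree (det A) \<le> (\<Sum>i<?N. if fst (bs ! i) = a then 1 else 0)"
    by (rule degree_det_le_row_degrees[OF A]) (auto simp: A_def)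
  also have "\<dots> = (\<Sum>b\<in>set bs. if fst b = a then 1 else 0)"
    by (rule sum_nth_distinct[OF bs(1)])
  also have "\<dots> = n a"
    unfolding bs(2) by (rule sum_Sigma_fst_indicator[OF finite_verts a])
  finally have deg: "degree (det A) \<le> n a" .
  have "poly (det A) s
      = det (1\<^sub>m ?N - kernel_mat bs (transport_kernel G (\<lambda>e. (y(a := s)) (tail G e) * x e) U))" for s
    unfolding transport_kernel_vertex_weight
    by (rule poly_det_cong[OF _ A]) (auto simp: A_def kernel_mat_def transport_kernel_vertex_weight)
  then show thesis using that[OF deg] by blast
qed

text \<open>
  For a single vertex \<open>a\<close>, the determinant has degree at most \<open>n a\<close> in \<open>y a\<close>, so the multisets that
  visit \<open>a\<close> more often contribute zero in total. Imposing this one vertex after another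
  bounds all visit numbers; the bound on the total length then holds automatically.
\<close>

lemma det_one_minus_transport_bounded:
  fixes U :: "'b \<Rightarrow> complex mat" and y :: "'a \<Rightarrow> complex"
  assumes U: "\<forall>e\<in>arcs G. U e \<in> carrier_mat (n (tail G e)) (n (head G e))"
    and bs: "distinct bs" "set bs = Sigma (verts G) (\<lambda>v. {..<n v})"
  shows "det (1\<^sub>m (length bs) - kernel_mat bs (transport_kernel G (\<lambda>e. y (tail G e) * x e) U))
    = (\<Sum>C\<in>bounded_multisets n. (\<Prod>a\<in>verts G. y a ^ mset_visits G a C) * mset_term (cycle_term x n U) C)"
proof -
  let ?F = "{C \<in> cycle_multisets G. (\<Sum>c\<in>#C. cycle_length c) \<le> length bs}"
  let ?D = "\<lambda>y. det (1\<^sub>m (length bs) - kernel_mat bs (transport_kernel G (\<lambda>e. y (tail G e) * x e) U))"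
  let ?W = "mset_term (cycle_term x n U)"
  have "\<forall>y. ?D y = (\<Sum>C\<in>{C \<in> ?F. \<forall>a\<in>S. mset_visits G a C \<le> n a}.
      (\<Prod>a\<in>verts G. y a ^ mset_visits G a C) * ?W C)" if "finite S" "S \<subseteq> verts G" for S
    using that
  proof (induction S rule: finite_induct)
    case empty
    then show ?case using det_one_minus_transport[OF U bs] by simp
  next
    case (insert a S)
    let ?FS = "{C \<in> ?F. \<forall>a\<in>S. mset_visits G a C \<le> n a}"
    have a: "a \<in> verts G" using insert.prems by simp
    have finFS: "finite ?FS" 
      by (rule finite_subset[OF _ finite_short_cycle_multisets[of "length bs"]]) auto
    show ?case
    proof
      fix y :: "'a \<Rightarrow> complex"
      let ?c = "\<lambda>C. (\<Prod>b\<in>verts G - {a}. y b ^ mset_visits G b C) * ?W C"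
      obtain P where deg: "degree P \<le> n a" and P: "\<And>s. poly P s = ?D (y(a := s))"
        using det_one_minus_transport_poly[OF bs a, of y x U] by blast
      have split: "(\<Prod>b\<in>verts G. (y(a := s)) b ^ mset_visits G b C) * ?W C = ?c C * s ^ mset_visits G a C"
        for s C
      proof -
        have "(\<Prod>b\<in>verts G. (y(a := s)) b ^ mset_visits G b C)
            = s ^ mset_visits G a C * (\<Prod>b\<in>verts G - {a}. (y(a := s)) b ^ mset_visits G b C)"
          by (subst prod.remove[OF finite_verts a]) simp
        also have "(\<Prod>b\<in>verts G - {a}. (y(a := s)) b ^ mset_visits G b C)
            = (\<Prod>b\<in>verts G - {a}. y b ^ mset_visits G b C)"
          by (rule prod.cong) auto
        finally show ?thesis by simp
      qed
      have eq: "poly P s = (\<Sum>C\<in>?FS. ?c C * s ^ mset_visits G a C)" for s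
      proof -
        have "poly P s = ?D (y(a := s))" by (rule P)
        also have "\<dots> = (\<Sum>C\<in>?FS. (\<Prod>b\<in>verts G. (y(a := s)) b ^ mset_visits G b C) * ?W C)"
          using insert.IH insert.prems by blast
        also have "\<dots> = (\<Sum>C\<in>?FS. ?c C * s ^ mset_visits G a C)"
          by (rule sum.cong[OF refl split])
        finally show ?thesis .
      qed
      have "?D y = poly P (y a)" using P[of "y a"] by simp
      also have "\<dots> = (\<Sum>C\<in>{C \<in> ?FS. mset_visits G a C \<le> n a}. ?c C * y a ^ mset_visits G a C)"
        by (rule poly_eq_truncated_sum[OF finFS deg eq])
      also have "\<dots> = (\<Sum>C\<in>{C \<in> ?F. \<forall>a\<in>insert a S. mset_visits G a C \<le> n a}.
          (\<Prod>a\<in>verts G. y a ^ mset_visits G a C) * ?W C)"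
      proof (rule sum.cong)
        fix C
        show "?c C * y a ^ mset_visits G a C = (\<Prod>a\<in>verts G. y a ^ mset_visits G a C) * ?W C"
          using split[of "y a" C] by (simp only: fun_upd_triv)
      qed auto
      finally show "?D y = \<dots>" .
    qed
  qed
  from this[OF finite_verts order_refl]
  have "?D y = (\<Sum>C\<in>{C \<in> ?F. \<forall>a\<in>verts G. mset_visits G a C \<le> n a}.
      (\<Prod>a\<in>verts G. y a ^ mset_visits G a C) * ?W C)" by blast
  also have "{C \<in> ?F. \<forall>a\<in>verts G. mset_visits G a C \<le> n a} = bounded_multisets n"
    using bounded_multisets_short[of _ n] length_coords[OF bs] by (auto simp: bounded_multisets_def)
  finally show ?thesis .
qed

section \<open>Arbitrary diagonal entries\<close>

lemma det_diagonal_kernel_mat: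
  fixes d :: "'k \<Rightarrow> 'c :: comm_ring_1"
  assumes "distinct bs"
  shows "det (kernel_mat bs (\<lambda>b c. if b = c then d b else 0)) = (\<Prod>b\<in>set bs. d b)"
proof -
  have "det (kernel_mat bs (\<lambda>b c. if b = c then d b else 0))
      = prod_list (diag_mat (kernel_mat bs (\<lambda>b c. if b = c then d b else 0)))"
    by (rule det_upper_triangular[OF _ kernel_mat_carrier])
       (auto simp: kernel_mat_def nth_eq_iff_index_eq[OF assms])
  also have "\<dots> = (\<Prod>i<length bs. d (bs ! i))"
    by (auto simp: prod_list_diag_prod kernel_mat_def atLeast0LessThan intro!: prod.cong)
  also have "\<dots> = (\<Prod>b\<in>set bs. d b)"
    by (rule prod.reindex_bij_betw[OF bij_betw_nth]) (use assms in auto)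
  finally show ?thesis .
qed

definition diag_minus_transport ::
  "('a \<Rightarrow> complex) \<Rightarrow> ('b \<Rightarrow> complex) \<Rightarrow> ('b \<Rightarrow> complex mat) \<Rightarrow> 'a \<times> nat \<Rightarrow> 'a \<times> nat \<Rightarrow> complex"
where
  "diag_minus_transport d x U b c = (if b = c then d (fst b) else 0) - transport_kernel G x U b c"

text \<open>
  Factor the invertible diagonal part out of the rows and use the vertex variables \<open>1 / d a\<close>.
\<close>

lemma det_diag_minus_transport_nonzero:
  fixes U :: "'b \<Rightarrow> complex mat" and d :: "'a \<Rightarrow> complex"
  assumes U: "\<forall>e\<in>arcs G. U e \<in> carrier_mat (n (tail G e)) (n (head G e))"
    and bs: "distinct bs" "set bs = Sigma (verts G) (\<lambda>v. {..<n v})"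
    and d: "\<And>a. a \<in> verts G \<Longrightarrow> d a \<noteq> 0"
  shows "det (kernel_mat bs (diag_minus_transport d x U))
    = (\<Sum>C\<in>bounded_multisets n. (\<Prod>a\<in>verts G. d a ^ (n a - mset_visits G a C)) * mset_term (cycle_term x n U) C)"
proof -
  let ?D = "kernel_mat bs (\<lambda>b c. if b = c then d (fst b) else 0)"
  let ?y = "\<lambda>a. 1 / d a"
  let ?T = "transport_kernel G (\<lambda>e. ?y (tail G e) * x e) U"
  have one: "1\<^sub>m (length bs) - kernel_mat bs ?T = kernel_mat bs (\<lambda>b c. (if b = c then 1 else 0) - ?T b c)"
    unfolding one_mat_eq_kernel_mat[OF bs(1)] by (rule eq_matI) (auto simp: kernel_mat_def)
  have "kernel_mat bs (diag_minus_transport d x U) = ?D * (1\<^sub>m (length bs) - kernel_mat bs ?T)"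
    unfolding one kernel_mat_mult[OF bs(1)]
  proof (rule kernel_mat_cong)
    fix b c assume b: "b \<in> set bs" and "c \<in> set bs"
    have "d (fst b) \<noteq> 0" using b d unfolding bs(2) by auto
    moreover have "?T b c = ?y (fst b) * transport_kernel G x U b c"
      by (rule transport_kernel_vertex_weight)
    ultimately have T: "transport_kernel G x U b c = d (fst b) * ?T b c" by simp
    have "(\<Sum>b'\<in>set bs. (if b = b' then d (fst b) else 0) * ((if b' = c then 1 else 0) - ?T b' c))
        = d (fst b) * ((if b = c then 1 else 0) - ?T b c)"
    proof -
      have "(\<Sum>b'\<in>set bs. (if b = b' then d (fst b) else 0) * ((if b' = c then 1 else 0) - ?T b' c))
          = (\<Sum>b'\<in>set bs. if b' = b then d (fst b) * ((if b = c then 1 else 0) - ?T b c) else 0)"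
        by (rule sum.cong) auto
      then show ?thesis using b by simp
    qed
    then show "diag_minus_transport d x U b c
        = (\<Sum>b'\<in>set bs. (if b = b' then d (fst b) else 0) * ((if b' = c then 1 else 0) - ?T b' c))"
      by (simp add: diag_minus_transport_def T right_diff_distrib)
  qed
  then have "det (kernel_mat bs (diag_minus_transport d x U)) = det ?D * det (1\<^sub>m (length bs) - kernel_mat bs ?T)"
    by (simp only: det_mult[OF kernel_mat_carrier minus_carrier_mat[OF kernel_mat_carrier]])
  also have "det ?D = (\<Prod>a\<in>verts G. d a ^ n a)"
  proof -
    have "det ?D = (\<Prod>b\<in>Sigma (verts G) (\<lambda>v. {..<n v}). d (fst b))"
      using det_diagonal_kernel_mat[OF bs(1), of "\<lambda>b. d (fst b)"] bs(2) by simp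
    also have "\<dots> = (\<Prod>a\<in>verts G. \<Prod>i<n a. d a)"
      by (subst prod.Sigma) (auto intro!: prod.cong)
    finally show ?thesis by simp
  qed
  also have "det (1\<^sub>m (length bs) - kernel_mat bs ?T) = (\<Sum>C\<in>bounded_multisets n.
      (\<Prod>a\<in>verts G. ?y a ^ mset_visits G a C) * mset_term (cycle_term x n U) C)"
    by (rule det_one_minus_transport_bounded[OF U bs])
  also have "(\<Prod>a\<in>verts G. d a ^ n a) * \<dots> = (\<Sum>C\<in>bounded_multisets n.
      (\<Prod>a\<in>verts G. d a ^ (n a - mset_visits G a C)) * mset_term (cycle_term x n U) C)"
    unfolding sum_distrib_left
  proof (rule sum.cong[OF refl])
    fix C assume C: "C \<in> bounded_multisets n"
    have "(\<Prod>a\<in>verts G. d a ^ n a) * (\<Prod>a\<in>verts G. ?y a ^ mset_visits G a C)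
        = (\<Prod>a\<in>verts G. d a ^ (n a - mset_visits G a C))"
      unfolding prod.distrib[symmetric]
      by (rule prod.cong)
         (use C d in \<open>auto simp: bounded_multisets_def power_diff power_one_over divide_simps\<close>)
    then show "(\<Prod>a\<in>verts G. d a ^ n a) *
        ((\<Prod>a\<in>verts G. ?y a ^ mset_visits G a C) * mset_term (cycle_term x n U) C)
        = (\<Prod>a\<in>verts G. d a ^ (n a - mset_visits G a C)) * mset_term (cycle_term x n U) C"
      by (simp add: mult.assoc[symmetric])
  qed
  finally show ?thesis .
qed

text \<open>
  Where some \<open>d a\<close> vanish, shift all of them by \<open>s\<close>: both sides are continuous in \<open>s\<close>, and \<open>d a + s\<close> is nonzero for all \<open>a\<close> when \<open>s\<close> is small and nonzero.
\<close>

lemma det_diag_minus_transport: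
  fixes U :: "'b \<Rightarrow> complex mat" and d :: "'a \<Rightarrow> complex"
  assumes U: "\<forall>e\<in>arcs G. U e \<in> carrier_mat (n (tail G e)) (n (head G e))"
    and bs: "distinct bs" "set bs = Sigma (verts G) (\<lambda>v. {..<n v})"
  shows "det (kernel_mat bs (diag_minus_transport d x U))
    = (\<Sum>C\<in>bounded_multisets n. (\<Prod>a\<in>verts G. d a ^ (n a - mset_visits G a C)) * mset_term (cycle_term x n U) C)"
    (is "?L d = ?R d")
proof -
  have L: "((\<lambda>s. ?L (\<lambda>a. d a + s)) \<longlongrightarrow> ?L (\<lambda>a. d a + 0)) (at 0)"
    unfolding det_def'[OF kernel_mat_carrier]
  proof (intro tendsto_intros)
    fix q i assume "q \<in> {q. q permutes {0..<length bs}}" and i: "i \<in> {0..<length bs}"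
    then have "q i < length bs" using permutes_in_image[of q "{0..<length bs}" i] by auto
    then have entry: "kernel_mat bs (diag_minus_transport f x U) $$ (i, q i)
        = (if bs ! i = bs ! q i then f (fst (bs ! i)) else 0) - transport_kernel G x U (bs ! i) (bs ! q i)" for f
      using i by (simp add: kernel_mat_def diag_minus_transport_def)
    show "((\<lambda>s. kernel_mat bs (diag_minus_transport (\<lambda>a. d a + s) x U) $$ (i, q i))
        \<longlongrightarrow> kernel_mat bs (diag_minus_transport (\<lambda>a. d a + 0) x U) $$ (i, q i)) (at 0)"
      unfolding entry by (cases "bs ! i = bs ! q i") (auto intro!: tendsto_eq_intros)
  qed
  have R: "((\<lambda>s. ?R (\<lambda>a. d a + s)) \<longlongrightarrow> ?R (\<lambda>a. d a + 0)) (at 0)"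
    by (intro tendsto_intros)
  have "\<forall>\<^sub>F s in at 0. \<forall>a\<in>verts G. d a + s \<noteq> 0"
  proof (rule eventually_ball_finite[OF finite_verts], intro ballI)
    fix a
    show "\<forall>\<^sub>F s in at 0. d a + s \<noteq> 0"
    proof (cases "d a = 0")
      case True
      then show ?thesis by (simp add: eventually_neq_at_within)
    next
      case False
      have "((\<lambda>s. d a + s) \<longlongrightarrow> d a + 0) (at 0)" by (intro tendsto_intros)
      then show ?thesis using False by (intro tendsto_imp_eventually_ne) auto
    qed
  qed
  then have "\<forall>\<^sub>F s in at 0. ?L (\<lambda>a. d a + s) = ?R (\<lambda>a. d a + s)"
    by (rule eventually_mono) (rule det_diag_minus_transport_nonzero[OF U bs], auto)
  then have "((\<lambda>s. ?R (\<lambda>a. d a + s)) \<longlongrightarrow> ?L (\<lambda>a. d a + 0)) (at 0)"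
    using L by (rule Lim_transform_eventually[rotated])
  from tendsto_unique[OF _ this R] show ?thesis by simp
qed

end

section \<open>Coordinates of the twisted Laplacian\<close>

lemma coord_list_Suc: "coord_list (Suc p) n = coord_list p n @ map (Pair (Suc p)) [0..<n (Suc p)]"
  by (simp add: coord_list_def)

lemma set_coord_list: "set (coord_list p n) = Sigma {1..p} (\<lambda>v. {..<n v})"
  by (auto simp: coord_list_def)

lemma distinct_coord_list: "distinct (coord_list p n)"
proof (induction p)
  case (Suc p)
  then show ?case
    unfolding coord_list_Suc by (auto simp: distinct_map inj_on_def set_coord_list)
qed (simp add: coord_list_def)

text \<open>
  Matches the recursion that defines block diagonal matrices.
\<close>

lemma kernel_mat_append:
  assumes "\<And>b c. b \<in> set bs \<Longrightarrow> c \<in> set cs \<Longrightarrow> K b c = 0 \<and> K c b = 0"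
  shows "kernel_mat (bs @ cs) K = four_block_mat (kernel_mat bs K) (0\<^sub>m (length bs) (length cs))
    (0\<^sub>m (length cs) (length bs)) (kernel_mat cs K)"
  by (rule eq_matI) (use assms in \<open>auto simp: kernel_mat_def nth_append\<close>)

lemma diag_scalar_blocks_eq_kernel_mat:
  "diag_scalar_blocks p n t = kernel_mat (coord_list p n) (\<lambda>b c. if b = c then t (fst b) else 0)"
proof (induction p)
  case 0
  then show ?case by (auto simp: diag_scalar_blocks_def coord_list_def kernel_mat_def)
next
  case (Suc p)
  let ?K = "\<lambda>b c. if b = c then t (fst b) else 0"
  let ?cs = "map (Pair (Suc p)) [0..<n (Suc p)]"
  have block: "kernel_mat ?cs ?K = t (Suc p) \<cdot>\<^sub>m 1\<^sub>m (n (Suc p))"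
    by (rule eq_matI) (auto simp: kernel_mat_def)
  have "diag_scalar_blocks (Suc p) n t = four_block_mat (diag_scalar_blocks p n t)
      (0\<^sub>m (dim_row (diag_scalar_blocks p n t)) (n (Suc p)))
      (0\<^sub>m (n (Suc p)) (dim_col (diag_scalar_blocks p n t))) (t (Suc p) \<cdot>\<^sub>m 1\<^sub>m (n (Suc p)))"
    by (simp add: diag_scalar_blocks_def diag_block_mat_last Let_def)
  also have "\<dots> = kernel_mat (coord_list p n @ ?cs) ?K"
    unfolding Suc.IH block[symmetric]
    by (subst kernel_mat_append) (auto simp: set_coord_list kernel_mat_def)
  finally show ?case by (simp only: coord_list_Suc)
qed

text \<open>
  The term \<open>f (s(e))\<close> of an edge stays at the vertex, so these terms add up to the scalar
  \<open>out_weight G x v\<close>; the term \<open>U e\<close> carries the value at \<open>t(e)\<close> to the vertex and gives the kernel.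
\<close>

lemma endo_matrix_twisted_laplacian:
  assumes "fin_digraph G" "verts G = {1..p}"
    and U: "\<forall>e\<in>arcs G. U e \<in> carrier_mat (n (tail G e)) (n (head G e))"
  shows "endo_matrix p n (twisted_laplacian G n x U) = kernel_mat (coord_list p n)
    (\<lambda>b c. (if b = c then out_weight G x (fst b) else 0) - transport_kernel G x U b c)"
proof -
  interpret fin_digraph G by fact
  have "twisted_laplacian G n x U (basis_section n c) (fst b) $ snd b
      = (if b = c then out_weight G x (fst b) else 0) - transport_kernel G x U b c"
    if b: "b \<in> set (coord_list p n)" and c: "c \<in> set (coord_list p n)" for b c
  proof -
    obtain v i u j where bc: "b = (v, i)" "c = (u, j)" by (cases b, cases c)
    have i: "i < n v" and j: "j < n u" using b c unfolding bc set_coord_list by auto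
    let ?f = "basis_section n c"
    have entry: "(x e \<cdot>\<^sub>v (?f (tail G e) - U e *\<^sub>v ?f (head G e))) $ i
        = (if b = c then x e else 0) - (if head G e = u then x e * U e $$ (i, j) else 0)"
      and dim: "x e \<cdot>\<^sub>v (?f (tail G e) - U e *\<^sub>v ?f (head G e)) \<in> carrier_vec (n v)"
      if e: "e \<in> out_arcs G v" for e
    proof -
      have Ue: "U e \<in> carrier_mat (n v) (n (head G e))" and t: "tail G e = v" using U e by auto
      have "(U e *\<^sub>v ?f (head G e)) $ i = (if head G e = u then U e $$ (i, j) else 0)"
        using Ue i j by (auto simp: basis_section_def bc)
      then show "(x e \<cdot>\<^sub>v (?f (tail G e) - U e *\<^sub>v ?f (head G e))) $ i
        = (if b = c then x e else 0) - (if head G e = u then x e * U e $$ (i, j) else 0)"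
        using Ue i j by (auto simp: t basis_section_def bc right_diff_distrib)
      show "x e \<cdot>\<^sub>v (?f (tail G e) - U e *\<^sub>v ?f (head G e)) \<in> carrier_vec (n v)"
        using Ue by (auto simp: t basis_section_def)
    qed
    have "twisted_laplacian G n x U ?f v $ i
        = (\<Sum>e\<in>out_arcs G v. (x e \<cdot>\<^sub>v (?f (tail G e) - U e *\<^sub>v ?f (head G e))) $ i)"
      unfolding twisted_laplacian_def using dim i by (intro index_finsum_vec) auto
    also have "\<dots> = (\<Sum>e\<in>out_arcs G v. if b = c then x e else 0)
        - (\<Sum>e\<in>out_arcs G v. if head G e = u then x e * U e $$ (i, j) else 0)"
      unfolding sum_subtractf[symmetric] by (rule sum.cong[OF refl entry])
    also have "(\<Sum>e\<in>out_arcs G v. if head G e = u then x e * U e $$ (i, j) else 0)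
        = transport_kernel G x U b c"
      unfolding transport_kernel_def bc fst_conv snd_conv
      by (rule sum.inter_filter[symmetric]) (simp add: out_arcs_def)
    also have "(\<Sum>e\<in>out_arcs G v. if b = c then x e else 0) = (if b = c then out_weight G x v else 0)"
      by (cases "b = c") (simp_all only: if_True if_False refl sum.neutral_const out_weight_def)
    finally show ?thesis by (simp add: bc)
  qed
  then show ?thesis
    unfolding endo_matrix_def Let_def kernel_mat_def by (intro eq_matI) auto
qed

section \<open>Expansion in the scalars\<close>

lemma prod_binomial_expansion:
  fixes t z :: "'v \<Rightarrow> 'c :: comm_semiring_1"
  assumes "finite V"
  shows "(\<Prod>a\<in>V. (t a + z a) ^ m a) = (\<Sum>k\<in>(\<Pi>\<^sub>E a\<in>V. {0..m a}).
    (\<Prod>a\<in>V. of_nat (m a choose k a) * t a ^ k a * z a ^ (m a - k a)))"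
proof -
  have "(\<Prod>a\<in>V. (t a + z a) ^ m a)
      = (\<Prod>a\<in>V. \<Sum>k\<in>{0..m a}. of_nat (m a choose k) * t a ^ k * z a ^ (m a - k))"
    by (simp add: binomial_ring atMost_atLeast0)
  also have "\<dots> = (\<Sum>k\<in>(\<Pi>\<^sub>E a\<in>V. {0..m a}).
      (\<Prod>a\<in>V. of_nat (m a choose k a) * t a ^ k a * z a ^ (m a - k a)))"
    by (rule prod_sum_PiE) (use assms in auto)
  finally show ?thesis .
qed

theorem theorem5p2:
  fixes G :: "(nat, 'e) pre_digraph"
    and p :: nat
    and n :: "nat \<Rightarrow> nat"
    and x :: "'e \<Rightarrow> complex"
    and U :: "'e \<Rightarrow> complex mat"
    and t :: "nat \<Rightarrow> complex"
  assumes "fin_digraph G"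
    and "loopfree_digraph G"
    and "verts G = {1..p}"
    and "\<And>v. v \<in> verts G \<Longrightarrow> n v \<ge> 1"
    and "\<And>e. e \<in> arcs G \<Longrightarrow> U e \<in> carrier_mat (n (tail G e)) (n (head G e))"
  shows "det (diag_scalar_blocks p n t + endo_matrix p n (twisted_laplacian G n x U)) =
    (\<Sum>k\<in>(\<Pi>\<^sub>E a\<in>{1..p}. {0..n a}).
      (\<Prod>a\<in>{1..p}. t a ^ k a) *
      (\<Sum>C\<in>{C \<in> cycle_multisets G. \<forall>a\<in>{1..p}. mset_visits G a C + k a \<le> n a}.
        (\<Prod>a\<in>{1..p}. of_nat ((n a - mset_visits G a C) choose k a)) *
        ((\<Prod>a\<in>{1..p}. out_weight G x a ^ (n a - k a - mset_visits G a C)) / mset_fact C) *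
        mset_weight x C *
        (\<Prod>c\<in>#C. - cycle_tr_hol G n U c / of_nat (cycle_val c))))"
proof -
  interpret fin_digraph G by fact
  have V: "verts G = {1..p}" by fact
  have U: "\<forall>e\<in>arcs G. U e \<in> carrier_mat (n (tail G e)) (n (head G e))" using assms(5) by blast
  let ?bs = "coord_list p n"
  let ?v = "\<lambda>a C. mset_visits G a C"
  let ?z = "out_weight G x"
  let ?W = "mset_term (cycle_term x n U)"
  let ?K = "\<Pi>\<^sub>E a\<in>{1..p}. {0..n a}"
  let ?B = "bounded_multisets n"
  let ?R = "\<lambda>k C. \<forall>a\<in>{1..p}. ?v a C + k a \<le> n a"
  let ?S = "\<lambda>k C. \<Prod>a\<in>{1..p}. of_nat ((n a - ?v a C) choose k a) * t a ^ k a * ?z a ^ (n a - ?v a C - k a)"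
  have bs: "distinct ?bs" "set ?bs = Sigma (verts G) (\<lambda>v. {..<n v})"
    by (simp_all add: distinct_coord_list set_coord_list V)
  have "diag_scalar_blocks p n t + endo_matrix p n (twisted_laplacian G n x U)
      = kernel_mat ?bs (diag_minus_transport (\<lambda>a. t a + ?z a) x U)"
    unfolding diag_scalar_blocks_eq_kernel_mat
      endo_matrix_twisted_laplacian[OF assms(1) V U]
    by (rule eq_matI) (auto simp: kernel_mat_def diag_minus_transport_def)
  then have "det (diag_scalar_blocks p n t + endo_matrix p n (twisted_laplacian G n x U))
      = (\<Sum>C\<in>?B. (\<Prod>a\<in>{1..p}. (t a + ?z a) ^ (n a - ?v a C)) * ?W C)"
    using det_diag_minus_transport[OF U bs] V by simp
  \<comment> \<open>For a fixed multiset, the admissible exponents k are those allowed by the binomial theorem.\<close>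
  also have "\<dots> = (\<Sum>C\<in>?B. \<Sum>k\<in>{k \<in> ?K. ?R k C}. ?S k C * ?W C)"
  proof (rule sum.cong[OF refl])
    fix C assume C: "C \<in> ?B"
    have "(\<Pi>\<^sub>E a\<in>{1..p}. {0..n a - ?v a C}) = {k \<in> ?K. ?R k C}"
    proof (intro equalityI subsetI)
      fix k assume k: "k \<in> (\<Pi>\<^sub>E a\<in>{1..p}. {0..n a - ?v a C})"
      have "k a \<le> n a \<and> ?v a C + k a \<le> n a" if "a \<in> {1..p}" for a
      proof -
        have "k a \<le> n a - ?v a C" using PiE_mem[OF k that] by simp
        moreover have "?v a C \<le> n a" using C that V by (simp add: bounded_multisets_def)
        ultimately show ?thesis by linarith
      qed
      then show "k \<in> {k \<in> ?K. ?R k C}" using PiE_arb[OF k] by (auto intro!: PiE_I)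
    next
      fix k assume k: "k \<in> {k \<in> ?K. ?R k C}"
      then have "k a \<le> n a - ?v a C" if "a \<in> {1..p}" for a
        using that by (auto simp: le_diff_conv2 add.commute dest!: bspec[of _ _ a])
      then show "k \<in> (\<Pi>\<^sub>E a\<in>{1..p}. {0..n a - ?v a C})" using k by (auto intro!: PiE_I dest: PiE_arb)
    qed
    then show "(\<Prod>a\<in>{1..p}. (t a + ?z a) ^ (n a - ?v a C)) * ?W C
        = (\<Sum>k\<in>{k \<in> ?K. ?R k C}. ?S k C * ?W C)"
      by (subst prod_binomial_expansion) (simp_all add: sum_distrib_right)
  qed
  also have "\<dots> = (\<Sum>k\<in>?K. \<Sum>C\<in>{C \<in> ?B. ?R k C}. ?S k C * ?W C)"
    by (rule sum.swap_restrict) (simp_all add: finite_bounded_multisets finite_PiE)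
  also have "\<dots> = (\<Sum>k\<in>?K. (\<Prod>a\<in>{1..p}. t a ^ k a) *
      (\<Sum>C\<in>{C \<in> cycle_multisets G. ?R k C}.
        (\<Prod>a\<in>{1..p}. of_nat ((n a - ?v a C) choose k a)) *
        ((\<Prod>a\<in>{1..p}. ?z a ^ (n a - k a - ?v a C)) / mset_fact C) *
        mset_weight x C *
        (\<Prod>c\<in>#C. - cycle_tr_hol G n U c / of_nat (cycle_val c))))"
    unfolding sum_distrib_left
  proof (intro sum.cong refl)
    fix k
    show "{C \<in> ?B. ?R k C} = {C \<in> cycle_multisets G. ?R k C}"
      using V by (auto simp: bounded_multisets_def intro: add_leD1)
    fix C
    have W: "?W C = mset_weight x C * (\<Prod>c\<in>#C. - cycle_tr_hol G n U c / of_nat (cycle_val c)) / mset_fact C"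
      unfolding mset_term_def cycle_term_def mset_weight_def by (simp only: prod_mset.distrib)
    have exponent: "n a - ?v a C - k a = n a - k a - ?v a C" for a by (rule diff_commute)
    have S: "?S k C = (\<Prod>a\<in>{1..p}. t a ^ k a) * (\<Prod>a\<in>{1..p}. of_nat ((n a - ?v a C) choose k a))
        * (\<Prod>a\<in>{1..p}. ?z a ^ (n a - k a - ?v a C))"
      unfolding exponent prod.distrib by (simp only: ac_simps)
    show "?S k C * ?W C = (\<Prod>a\<in>{1..p}. t a ^ k a) *
        ((\<Prod>a\<in>{1..p}. of_nat ((n a - ?v a C) choose k a)) *
        ((\<Prod>a\<in>{1..p}. ?z a ^ (n a - k a - ?v a C)) / mset_fact C) *
        mset_weight x C *
        (\<Prod>c\<in>#C. - cycle_tr_hol G n U c / of_nat (cycle_val c)))"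
      unfolding W S by (simp add: ac_simps)
  qed
  finally show ?thesis .
qed

end
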